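(* Let $\ell\ge5$ be a prime. For every even lattice $\Lambda$ whose level is a power of $\ell$ there exists an even lattice $\widehat\Lambda$ which possesses an automorphism $\sigma$ of $\ell$-power order such that the sublattice of $\widehat\Lambda$ fixed by $\sigma$ is isomorphic to $\Lambda$; moreover $\widehat\Lambda$ can be chosen so that its rank equals $e(\Lambda)$ and its level is not divisible by $\ell$ nor by any prime $p\equiv-1\pmod{\ell}$.
   Context: A lattice $(L,b)$ is a free $\mathbb{Z}$-module of finite rank with a symmetric positive definite bilinear form $b$; it is even if $b(x,x)\in2\mathbb{Z}$ for all $x$. With $G$ a Gram matrix of $b$, the elementary divisors of the lattice are those of $G$, $e(\Lambda)$ denotes their sum, and the level is the smallest natural $l$ such that $lG^{-1}$ is integral with even diagonal. An automorphism is a $b$-preserving $\mathbb{Z}$-linear bijection; the fixed sublattice is $\{x:\sigma x=x\}$ with the restricted form; isomorphism of lattices means isometry. *)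

theory Defs
  imports
    "HOL-Algebra.Bij"
    "HOL-Algebra.IntRing"
    "HOL-Algebra.Multiplicative_Group"
    "HOL-Number_Theory.Cong"
    "Jordan_Normal_Form.Matrix"
begin

text \<open>
  The form takes values in the integers. No even lattice is lost: if \<open>b(x,x)\<close> is always an
  even integer, then \<open>2 b(x,y) = b(x+y,x+y) - b(x,x) - b(y,y)\<close> shows that \<open>b\<close> is integral.
  As usual in HOL-Algebra, modules are extensions of the ring record; the fields \<^const>\<open>mult\<close>
  and \<^const>\<open>one\<close> of a lattice play no role.
\<close>

record 'a zlattice = "(int, 'a) module" +
  form :: "'a \<Rightarrow> 'a \<Rightarrow> int"

definition zbasis :: "(int, 'a, 'm) module_scheme \<Rightarrow> 'a list \<Rightarrow> bool" where
  "zbasis L bs \<longleftrightarrow> set bs \<subseteq> carrier L \<and>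
     bij_betw (\<lambda>v. finsum L (\<lambda>i. v $ i \<odot>\<^bsub>L\<^esub> bs ! i) {..<length bs})
       (carrier_vec (length bs)) (carrier L)"

locale zlattice = module int_ring L for L :: "('a, 'm) zlattice_scheme" (structure) +
  assumes free_finite_rank: "\<exists>bs. zbasis L bs"
    and form_add_left: "\<lbrakk>x \<in> carrier L; y \<in> carrier L; z \<in> carrier L\<rbrakk>
          \<Longrightarrow> form L (x \<oplus> y) z = form L x z + form L y z"
    and form_smult_left: "\<lbrakk>x \<in> carrier L; y \<in> carrier L\<rbrakk>
          \<Longrightarrow> form L (k \<odot> x) y = k * form L x y"
    and form_sym: "\<lbrakk>x \<in> carrier L; y \<in> carrier L\<rbrakk> \<Longrightarrow> form L x y = form L y x"
    and form_pos_def: "\<lbrakk>x \<in> carrier L; x \<noteq> \<zero>\<rbrakk> \<Longrightarrow> form L x x > 0"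

definition even_lattice :: "('a, 'm) zlattice_scheme \<Rightarrow> bool" where
  "even_lattice L \<longleftrightarrow> zlattice L \<and> (\<forall>x\<in>carrier L. even (form L x x))"

definition lattice_rank :: "('a, 'm) zlattice_scheme \<Rightarrow> nat" where
  "lattice_rank L = (THE n. \<exists>bs. zbasis L bs \<and> length bs = n)"

definition gram :: "('a, 'm) zlattice_scheme \<Rightarrow> 'a list \<Rightarrow> int mat" where
  "gram L bs = mat (length bs) (length bs) (\<lambda>(i, j). form L (bs ! i) (bs ! j))"

text \<open>
  Level and elementary divisors are read off from an arbitrarily chosen Gram matrix; a change of
  basis replaces \<open>G\<close> by \<open>U\<^sup>T G U\<close> with \<open>U\<close> unimodular, which affects neither.
\<close>

definition gram_matrix :: "('a, 'm) zlattice_scheme \<Rightarrow> int mat" where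
  "gram_matrix L = (SOME G. \<exists>bs. zbasis L bs \<and> G = gram L bs)"

text \<open>
  The elementary divisors of a nonsingular matrix are the diagonal entries (units included) of
  its Smith normal form. These exist and are unique.
\<close>

definition smith_diagonal :: "int mat \<Rightarrow> nat list \<Rightarrow> bool" where
  "smith_diagonal A ds \<longleftrightarrow> length ds = dim_row A \<and>
     (\<forall>i. Suc i < length ds \<longrightarrow> ds ! i dvd ds ! Suc i) \<and>
     (\<exists>P \<in> carrier_mat (dim_row A) (dim_row A). \<exists>Q \<in> carrier_mat (dim_row A) (dim_row A).
        invertible_mat P \<and> invertible_mat Q \<and>
        P * A * Q = mat_diag (dim_row A) (\<lambda>i. int (ds ! i)))"

definition elementary_divisors :: "('a, 'm) zlattice_scheme \<Rightarrow> nat list" where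
  "elementary_divisors L = (SOME ds. smith_diagonal (gram_matrix L) ds)"

definition elementary_divisor_sum :: "('a, 'm) zlattice_scheme \<Rightarrow> nat" where
  "elementary_divisor_sum L = sum_list (elementary_divisors L)"

definition integral_even_diag :: "rat mat \<Rightarrow> bool" where
  "integral_even_diag A \<longleftrightarrow>
     (\<exists>B. A = map_mat of_int B \<and> (\<forall>i < dim_row B. even (B $$ (i, i))))"

definition lattice_level :: "('a, 'm) zlattice_scheme \<Rightarrow> nat" where
  "lattice_level L = (let G = map_mat rat_of_int (gram_matrix L) in
     LEAST l. l > 0 \<and>
       (\<exists>H. H \<in> carrier_mat (dim_row G) (dim_row G) \<and> inverts_mat G H \<and> inverts_mat H G \<and>
            integral_even_diag (of_nat l \<cdot>\<^sub>m H)))"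

definition lattice_isometry ::
  "('a, 'm) zlattice_scheme \<Rightarrow> ('b, 'n) zlattice_scheme \<Rightarrow> ('a \<Rightarrow> 'b) \<Rightarrow> bool" where
  "lattice_isometry L M f \<longleftrightarrow> bij_betw f (carrier L) (carrier M) \<and>
     (\<forall>x\<in>carrier L. \<forall>y\<in>carrier L. f (x \<oplus>\<^bsub>L\<^esub> y) = f x \<oplus>\<^bsub>M\<^esub> f y) \<and>
     (\<forall>k. \<forall>x\<in>carrier L. f (k \<odot>\<^bsub>L\<^esub> x) = k \<odot>\<^bsub>M\<^esub> f x) \<and>
     (\<forall>x\<in>carrier L. \<forall>y\<in>carrier L. form M (f x) (f y) = form L x y)"

definition isometric :: "('a, 'm) zlattice_scheme \<Rightarrow> ('b, 'n) zlattice_scheme \<Rightarrow> bool" where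
  "isometric L M \<longleftrightarrow> (\<exists>f. lattice_isometry L M f)"

text \<open>As for \<^const>\<open>AutoGroup\<close>, automorphisms are extensional functions on the carrier.\<close>

definition lattice_Aut :: "('a, 'm) zlattice_scheme \<Rightarrow> ('a \<Rightarrow> 'a) monoid" where
  "lattice_Aut L =
     BijGroup (carrier L) \<lparr>carrier := {f \<in> Bij (carrier L). lattice_isometry L L f}\<rparr>"

lemma (in zlattice) group_lattice_Aut: "group (lattice_Aut L)"
proof -
  let ?H = "{f \<in> Bij (carrier L). lattice_isometry L L f}"
  have cl: "f x \<in> carrier L" if "f \<in> Bij (carrier L)" "x \<in> carrier L" for f x
    using that by (auto simp: Bij_def dest: bij_betwE)
  have "subgroup ?H (BijGroup (carrier L))"
  proof (rule group.subgroupI[OF group_BijGroup])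
    show "?H \<subseteq> carrier (BijGroup (carrier L))"
      by (auto simp: BijGroup_def)
    have "restrict id (carrier L) \<in> ?H"
      using id_Bij[of "carrier L"]
      by (auto simp: lattice_isometry_def Bij_def id_def)
    then show "?H \<noteq> {}" by blast
  next
    fix f assume f: "f \<in> ?H"
    then have fB: "f \<in> Bij (carrier L)" and
      fa: "\<And>x y. x \<in> carrier L \<Longrightarrow> y \<in> carrier L \<Longrightarrow> f (x \<oplus> y) = f x \<oplus> f y" and
      fs: "\<And>k x. x \<in> carrier L \<Longrightarrow> f (k \<odot> x) = k \<odot> f x" and
      ff: "\<And>x y. x \<in> carrier L \<Longrightarrow> y \<in> carrier L \<Longrightarrow> form L (f x) (f y) = form L x y"
      by (auto simp: lattice_isometry_def)
    let ?g = "restrict (inv_into (carrier L) f) (carrier L)"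
    have bij: "bij_betw f (carrier L) (carrier L)" using fB by (simp add: Bij_def)
    have gB: "?g \<in> Bij (carrier L)" by (rule restrict_inv_into_Bij[OF fB])
    have gc: "?g x \<in> carrier L" if "x \<in> carrier L" for x using cl[OF gB that] .
    have fg: "f (?g x) = x" if "x \<in> carrier L" for x
      using that bij by (simp add: bij_betw_inv_into_right)
    have gf: "?g (f x) = x" if "x \<in> carrier L" for x
      using that bij cl[OF fB] by (simp add: bij_betw_inv_into_left)
    have sc: "k \<odot> x \<in> carrier L" if "x \<in> carrier L" for k :: int and x
      using that by simp
    have "lattice_isometry L L ?g"
      unfolding lattice_isometry_def
    proof (intro conjI ballI allI)
      show "bij_betw ?g (carrier L) (carrier L)" using gB by (simp add: Bij_def)
    next
      fix x y assume x: "x \<in> carrier L" and y: "y \<in> carrier L"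
      have "x \<oplus> y = f (?g x \<oplus> ?g y)" using fa[OF gc[OF x] gc[OF y]] fg[OF x] fg[OF y] by simp
      then show "?g (x \<oplus> y) = ?g x \<oplus> ?g y"
        using gf[of "?g x \<oplus> ?g y"] gc[OF x] gc[OF y] by (metis add.m_closed)
      show "form L (?g x) (?g y) = form L x y"
        using ff[OF gc[OF x] gc[OF y]] fg[OF x] fg[OF y] by simp
    next
      fix k x assume x: "x \<in> carrier L"
      have "k \<odot> x = f (k \<odot> ?g x)" using fs[OF gc[OF x]] fg[OF x] by simp
      then show "?g (k \<odot> x) = k \<odot> ?g x"
        using gf[OF sc[OF gc[OF x]]] by metis
    qed
    then show "inv\<^bsub>BijGroup (carrier L)\<^esub> f \<in> ?H"
      using gB fB by (simp add: inv_BijGroup)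
  next
    fix f g assume f: "f \<in> ?H" and g: "g \<in> ?H"
    then have B: "f \<in> Bij (carrier L)" "g \<in> Bij (carrier L)" by auto
    have "compose (carrier L) f g \<in> Bij (carrier L)" by (rule compose_Bij[OF B])
    moreover have "lattice_isometry L L (compose (carrier L) f g)"
      using f g calculation cl[OF B(1)] cl[OF B(2)]
      by (auto simp: lattice_isometry_def compose_def Bij_def)
    ultimately show "f \<otimes>\<^bsub>BijGroup (carrier L)\<^esub> g \<in> ?H"
      using B by (simp add: BijGroup_def)
  qed
  then show ?thesis
    unfolding lattice_Aut_def by (rule subgroup.subgroup_is_group[OF _ group_BijGroup])
qed

definition fixed_sublattice :: "'a zlattice \<Rightarrow> ('a \<Rightarrow> 'a) \<Rightarrow> 'a zlattice" where
  "fixed_sublattice L \<sigma> = L \<lparr>carrier := {x \<in> carrier L. \<sigma> x = x}\<rparr>"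

end

theory Submission
  imports Defs "Jordan_Normal_Form.Determinant"
begin

text \<open>
  Since \<open>l\<close> is odd, a unimodular change of basis brings a Gram matrix of \<open>\<Lambda>\<close> to a matrix \<open>g\<close> that is
  diagonal modulo \<open>l\<^sup>2\<^sup>k\<close>, where \<open>l\<^sup>k\<close> is the level, with \<open>g i i = d i * a i\<close>, \<open>d i\<close> a power of \<open>l\<close>
  and \<open>a i\<close> prime to \<open>l\<close>. The \<open>d i\<close> are then the elementary divisors. Write
  \<open>a i \<equiv> q i * (r i)\<^sup>2\<close> modulo \<open>l\<^sup>k\<close> with \<open>0 < q i < l\<close> (Hensel).

  The new lattice lives in the direct sum of free groups (blocks) of rank \<open>d i\<close>, whose coordinates are
  permuted cyclically by \<open>\<sigma>\<close>: it consists of the \<open>y\<close> whose sum over the \<open>i\<close>-th block is \<open>r i * X i\<close>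
  for some integer \<open>X i\<close>, and its form is the sum of \<open>q i\<close> times the standard form on each block and of
  a form \<open>\<gamma>\<close> in the \<open>X i\<close> (\<open>gam\<close> below), chosen
  so that the block-constant vectors carry exactly \<open>g\<close>. The corrections \<open>\<gamma>\<close> are integral by the
  congruences above. Positivity follows from the Cauchy-Schwarz inequality in every block. The matrix
  \<open>g\<close> with its \<open>j\<close>-th column divided by \<open>d j\<close> is unimodular, so \<open>\<Prod>i. q i\<close> annihilates the
  discriminant group; its prime divisors are less than \<open>l\<close>, and \<open>l - 1\<close> is even and hence not prime.
\<close>

section \<open>Integer matrices\<close>

text \<open>Gaussian elimination without division. If the equation \<open>i\<^sub>0\<close> has a
  nonzero coefficient at \<open>j\<^sub>0\<close>, cross-multiplication removes that unknown from
  the other equations; scaling the remaining unknowns by this coefficient then makes the value at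
  \<open>j\<^sub>0\<close> integral.\<close>

lemma int_kernel_vector:
  fixes f :: "'i \<Rightarrow> 'j \<Rightarrow> int"
  assumes "finite I" "finite J" "card I < card J"
  shows "\<exists>x. (\<exists>j\<in>J. x j \<noteq> 0) \<and> (\<forall>i\<in>I. (\<Sum>j\<in>J. f i j * x j) = 0)"
  using assms
proof (induction I arbitrary: J f rule: finite_induct)
  case empty
  then have "J \<noteq> {}" by auto
  then show ?case by (intro exI[of _ "\<lambda>_. 1"]) auto
next
  case (insert i\<^sub>0 I)
  show ?case
  proof (cases "\<forall>j\<in>J. f i\<^sub>0 j = 0")
    case True
    have "card I < card J" using insert.prems insert.hyps by simp
    from insert.IH[OF insert.prems(1) this, of f] True show ?thesis by auto
  next
    case False
    then obtain j\<^sub>0 where j0: "j\<^sub>0 \<in> J" "f i\<^sub>0 j\<^sub>0 \<noteq> 0" by blast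
    let ?c = "f i\<^sub>0 j\<^sub>0" and ?J = "J - {j\<^sub>0}"
    have "card I < card ?J" using insert j0 by auto
    from insert.IH[OF _ this, of "\<lambda>i j. ?c * f i j - f i j\<^sub>0 * f i\<^sub>0 j"] insert.prems(1)
    obtain x where x: "\<exists>j\<in>?J. x j \<noteq> 0"
      and x0: "\<And>i. i \<in> I \<Longrightarrow> (\<Sum>j\<in>?J. (?c * f i j - f i j\<^sub>0 * f i\<^sub>0 j) * x j) = 0"
      by auto
    define y where "y j = (if j = j\<^sub>0 then - (\<Sum>j\<in>?J. f i\<^sub>0 j * x j) else ?c * x j)" for j
    have S: "(\<Sum>j\<in>J. f i j * y j) = (\<Sum>j\<in>?J. (?c * f i j - f i j\<^sub>0 * f i\<^sub>0 j) * x j)" for i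
    proof -
      have "(\<Sum>j\<in>J. f i j * y j) = f i j\<^sub>0 * y j\<^sub>0 + (\<Sum>j\<in>?J. f i j * y j)"
        using insert.prems(1) j0(1) by (rule sum.remove)
      also have "(\<Sum>j\<in>?J. f i j * y j) = (\<Sum>j\<in>?J. ?c * f i j * x j)"
        by (intro sum.cong) (auto simp: y_def)
      finally show ?thesis
        by (simp add: y_def algebra_simps sum_subtractf sum_distrib_left)
    qed
    have "(\<Sum>j\<in>J. f i j * y j) = 0" if "i \<in> insert i\<^sub>0 I" for i
      using that x0[of i] unfolding S by (auto simp: algebra_simps)
    moreover have "\<exists>j\<in>J. y j \<noteq> 0" using x j0 by (auto simp: y_def)
    ultimately show ?thesis by blast
  qed
qed

text \<open>A nonzero solution stays a solution after division by the gcd of its entries.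
  Primitivity allows a number to be recovered, up to sign, as the gcd of its products with the
  entries.\<close>

lemma int_kernel_primitive:
  fixes f :: "'i \<Rightarrow> 'j \<Rightarrow> int"
  assumes "finite I" "finite J" "card I < card J"
  shows "\<exists>x. Gcd (x ` J) = 1 \<and> (\<forall>i\<in>I. (\<Sum>j\<in>J. f i j * x j) = 0)"
proof -
  obtain x j\<^sub>0 where j0: "j\<^sub>0 \<in> J" "x j\<^sub>0 \<noteq> 0" and x0: "\<And>i. i \<in> I \<Longrightarrow> (\<Sum>j\<in>J. f i j * x j) = 0"
    using int_kernel_vector[OF assms, of f] by blast
  define g where "g = Gcd (x ` J)"
  have g: "g \<noteq> 0" using j0 by (auto simp: g_def Gcd_0_iff)
  have gx: "g * (x j div g) = x j" if "j \<in> J" for j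
    using that by (simp add: g_def)
  have "g = Gcd ((*) g ` (\<lambda>j. x j div g) ` J)"
    using gx unfolding g_def[symmetric] by (simp add: image_image g_def cong: image_cong_simp)
  also have "\<dots> = normalize (g * Gcd ((\<lambda>j. x j div g) ` J))" by (rule Gcd_mult)
  finally have "g = g * Gcd ((\<lambda>j. x j div g) ` J)" by (simp add: abs_mult g_def)
  then have "Gcd ((\<lambda>j. x j div g) ` J) = 1" using g by simp
  moreover have "(\<Sum>j\<in>J. f i j * (x j div g)) = 0" if "i \<in> I" for i
  proof -
    have "g * (\<Sum>j\<in>J. f i j * (x j div g)) = (\<Sum>j\<in>J. f i j * x j)"
      unfolding sum_distrib_left by (intro sum.cong refl) (metis gx mult.left_commute)
    then show ?thesis using x0[OF that] g by simp
  qed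
  ultimately show ?thesis by blast
qed

section \<open>Uniqueness of the Smith normal form\<close>

lemma nat_chain_dvd:
  fixes ds :: "nat list"
  assumes "\<forall>i. Suc i < length ds \<longrightarrow> ds ! i dvd ds ! Suc i" "i \<le> j" "j < length ds"
  shows "ds ! i dvd ds ! j"
  using assms(2,3)
proof (induction j rule: dec_induct)
  case (step k)
  then show ?case using assms(1) by (meson Suc_lessD dvd_trans)
qed simp

lemma smith_diagonal_dvd:
  fixes ds es :: "nat list"
  assumes ds: "\<And>i j. i \<le> j \<Longrightarrow> j < n \<Longrightarrow> ds ! i dvd ds ! j"
    and es: "\<And>i j. i \<le> j \<Longrightarrow> j < n \<Longrightarrow> es ! i dvd es ! j"
    and A: "A \<in> carrier_mat n n" and B: "B \<in> carrier_mat n n"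
    and eq: "mat_diag n (\<lambda>i. int (ds ! i)) = A * mat_diag n (\<lambda>i. int (es ! i)) * B"
    and r: "r < n"
  shows "es ! r dvd ds ! r"
proof -
  \<comment> \<open>a primitive vector in the first \<open>r + 1\<close> coordinates on which the first \<open>r\<close> rows of \<open>B\<close> vanish:
    the remaining diagonal entries of the right-hand side are all divisible by \<open>es ! r\<close>\<close>
  obtain x where x: "Gcd (x ` {..r}) = 1"
    and x0: "\<And>i. i < r \<Longrightarrow> (\<Sum>j\<le>r. B $$ (i, j) * x j) = 0"
    using int_kernel_primitive[of "{..<r}" "{..r}" "\<lambda>i j. B $$ (i, j)"] by auto
  have eq': "(if i = j then int (ds ! i) else 0) =
      (\<Sum>m<n. A $$ (i, m) * int (es ! m) * B $$ (m, j))" if "i < n" "j < n" for i j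
  proof -
    have "(mat_diag n (\<lambda>i. int (ds ! i))) $$ (i, j) = (if i = j then int (ds ! i) else 0)"
      using that by (auto simp: mat_diag_def)
    then show ?thesis
      unfolding eq mat_diag_mult_right[OF A] using that A B
      by (simp add: scalar_prod_def atLeast0LessThan)
  qed
  have dv: "int (es ! r) dvd int (ds ! r) * x i" if i: "i \<le> r" for i
  proof -
    have "int (ds ! i) * x i = (\<Sum>j\<le>r. (if i = j then int (ds ! i) else 0) * x j)"
      using i by (subst sum.remove[of _ i]) auto
    also have "\<dots> = (\<Sum>j\<le>r. \<Sum>m<n. A $$ (i, m) * int (es ! m) * B $$ (m, j) * x j)"
      using i r by (intro sum.cong refl) (subst eq', auto simp: sum_distrib_right)
    also have "\<dots> = (\<Sum>m<n. A $$ (i, m) * int (es ! m) * (\<Sum>j\<le>r. B $$ (m, j) * x j))"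
      by (subst sum.swap) (simp add: sum_distrib_left mult.assoc)
    also have "int (es ! r) dvd \<dots>"
    proof (rule dvd_sum)
      fix m assume "m \<in> {..<n}"
      then show "int (es ! r) dvd A $$ (i, m) * int (es ! m) * (\<Sum>j\<le>r. B $$ (m, j) * x j)"
        using x0[of m] es[of r m] by (cases "m < r") auto
    qed
    finally have "int (es ! r) dvd int (ds ! i) * x i" .
    moreover have "int (ds ! i) * x i dvd int (ds ! r) * x i"
      using ds[OF i r] by (simp add: mult_dvd_mono)
    ultimately show ?thesis by (rule dvd_trans)
  qed
  \<comment> \<open>As \<open>x\<close> is primitive, the common divisor \<open>es ! r\<close> of
    all products \<open>ds ! r * x i\<close> divides \<open>ds ! r\<close> itself.\<close>
  have "Gcd ((*) (int (ds ! r)) ` x ` {..r}) = int (ds ! r)"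
    unfolding Gcd_mult x by simp
  moreover have "int (es ! r) dvd Gcd ((*) (int (ds ! r)) ` x ` {..r})"
    by (rule Gcd_greatest) (use dv in auto)
  ultimately show ?thesis by simp
qed

lemma invertible_matE:
  assumes "invertible_mat P" "P \<in> carrier_mat n n"
  obtains X where "X * P = 1\<^sub>m n" "X \<in> carrier_mat n n" "P * X = 1\<^sub>m n"
  using assms unfolding invertible_mat_def inverts_mat_def
  by (metis carrier_matD carrier_matI index_mult_mat(2,3) index_one_mat(2,3))

lemma invertible_matI:
  assumes "P \<in> carrier_mat n n" "X \<in> carrier_mat n n" "X * P = 1\<^sub>m n" "P * X = 1\<^sub>m n"
  shows "invertible_mat P"
  using assms unfolding invertible_mat_def inverts_mat_def by auto

lemma invertible_mat_mult:
  assumes P: "P \<in> carrier_mat n n" "invertible_mat P" and Q: "Q \<in> carrier_mat n n" "invertible_mat Q"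
  shows "invertible_mat (P * Q)"
proof -
  obtain X where X: "X * P = 1\<^sub>m n" "X \<in> carrier_mat n n" "P * X = 1\<^sub>m n"
    using invertible_matE[OF P(2,1)] .
  obtain Y where Y: "Y * Q = 1\<^sub>m n" "Y \<in> carrier_mat n n" "Q * Y = 1\<^sub>m n"
    using invertible_matE[OF Q(2,1)] .
  have "(Y * X) * (P * Q) = Y * (X * P) * Q" "(P * Q) * (Y * X) = P * (Q * Y) * X"
    using P Q X(2) Y(2) by (simp_all add: assoc_mult_mat[of _ n n _ n _ n] mult_carrier_mat[of _ n n _ n])
  then show ?thesis
    using P Q X Y by (intro invertible_matI[of _ n "Y * X"]) auto
qed

text \<open>Inverting the transformations of one form expresses the other as an integral two-sided
  multiple of it. The entrywise divisibility obtained this way holds in both directions, and the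
  entries are natural numbers.\<close>

lemma smith_diagonal_unique:
  assumes ds: "smith_diagonal G ds" and es: "smith_diagonal G es" and G: "G \<in> carrier_mat n n"
  shows "ds = es"
proof -
  have dvd: "es ! r dvd ds ! r"
    if ds: "smith_diagonal G ds" and es: "smith_diagonal G es" and r: "r < n" for ds es r
  proof -
    have chain: "f ! i dvd f ! j" if "smith_diagonal G f" "i \<le> j" "j < n" for f i j
      using nat_chain_dvd[of f i j] that G by (auto simp: smith_diagonal_def)
    obtain P Q where P: "P \<in> carrier_mat n n" and Q: "Q \<in> carrier_mat n n"
      and D: "P * G * Q = mat_diag n (\<lambda>i. int (ds ! i))"
      using ds G by (auto simp: smith_diagonal_def)
    obtain P' Q' where P': "P' \<in> carrier_mat n n" "invertible_mat P'"
      and Q': "Q' \<in> carrier_mat n n" "invertible_mat Q'"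
      and D': "P' * G * Q' = mat_diag n (\<lambda>i. int (es ! i))"
      using es G by (auto simp: smith_diagonal_def)
    obtain X where X: "X * P' = 1\<^sub>m n" "X \<in> carrier_mat n n"
      using invertible_matE[OF P'(2,1)] by blast
    obtain Y where Y: "Q' * Y = 1\<^sub>m n" "Y \<in> carrier_mat n n"
      using invertible_matE[OF Q'(2,1)] by blast
    have "X * (P' * G * Q') * Y = (X * P') * G * (Q' * Y)"
      using X(2) P'(1) G Q'(1) Y(2) by (simp add: assoc_mult_mat[of _ n n _ n _ n])
    then have "G = X * mat_diag n (\<lambda>i. int (es ! i)) * Y" using D' X Y G by simp
    then have "mat_diag n (\<lambda>i. int (ds ! i)) = P * (X * mat_diag n (\<lambda>i. int (es ! i)) * Y) * Q"
      using D by simp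
    also have "\<dots> = (P * X) * mat_diag n (\<lambda>i. int (es ! i)) * (Y * Q)"
      using X(2) P Y(2) Q by (simp add: assoc_mult_mat[of _ n n _ n _ n] mult_carrier_mat[of _ n n _ n])
    finally show ?thesis
      using smith_diagonal_dvd[of n ds es "P * X" "Y * Q"] chain[OF ds] chain[OF es] P Q X Y r by simp
  qed
  have "length ds = n" "length es = n" using ds es G by (auto simp: smith_diagonal_def)
  then show ?thesis
    using dvd[OF ds es] dvd[OF es ds] by (intro nth_equalityI) (auto intro: dvd_antisym)
qed


section \<open>Diagonalization modulo a prime power\<close>

text \<open>Newton iteration for \<open>q * r\<^sup>2 = a\<close>, starting from
  \<open>r = 1\<close>. Carrying along that \<open>r\<close> is 1 modulo \<open>p\<close> keeps the
  derivative \<open>2 * q * r\<close> a unit modulo \<open>p\<close>.\<close>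

lemma hensel_square:
  fixes p a q :: int
  assumes p: "prime p" "odd p" and q: "\<not> p dvd q" and aq: "p dvd a - q"
  shows "\<exists>r. p dvd r - 1 \<and> p ^ k dvd a - q * r\<^sup>2"
proof (induction k)
  case 0
  show ?case by (intro exI[of _ 1]) auto
next
  case (Suc k)
  \<comment> \<open>A Newton step leaves an error of order \<open>p ^ (2 * k)\<close>, which
    improves on \<open>p ^ k\<close> only for positive \<open>k\<close>; the passage from exponent 0
    to 1 is the hypothesis \<open>aq\<close>.\<close>
  show ?case
  proof (cases "k = 0")
    case True
    then show ?thesis using aq by (intro exI[of _ 1]) auto
  next
    case False
    from Suc obtain r c where r: "p dvd r - 1" and c: "a - q * r\<^sup>2 = p ^ k * c" by (metis dvdE)
    have unit: "\<not> p dvd 1" using p(1) not_prime_unit by blast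
    have pr: "\<not> p dvd r"
    proof
      assume "p dvd r"
      from dvd_diff[OF this r] unit show False by simp
    qed
    have p2: "\<not> p dvd 2"
      using p prime_ge_2_int[OF p(1)] zdvd_imp_le[of p 2] by fastforce
    have "\<not> p dvd 2 * q * r"
      using p2 q pr p(1) by (simp add: prime_dvd_mult_iff)
    then have "coprime p (2 * q * r)" using p(1) by (intro prime_imp_coprime)
    then obtain v where "[(2 * q * r) * v = 1] (mod p)"
      using cong_solve_coprime_int[of "2 * q * r" p] by (auto simp: coprime_commute)
    then have "p dvd 2 * q * r * v - 1" by (simp add: cong_iff_dvd_diff)
    then have "p dvd (2 * q * r * v - 1) * - c" by (rule dvd_mult2)
    moreover define s where "s = v * c"
    ultimately have s: "p dvd c - 2 * q * r * s" by (simp add: algebra_simps)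
    have "a - q * (r + p ^ k * s)\<^sup>2 = p ^ k * (c - 2 * q * r * s) - p ^ k * (p ^ k) * (q * s\<^sup>2)"
      using c by (simp add: power2_eq_square algebra_simps)
    moreover have "p ^ Suc k dvd p ^ k * (c - 2 * q * r * s)" using s by (simp add: mult.commute)
    moreover have "p ^ Suc k dvd p ^ k * p ^ k * (q * s\<^sup>2)"
      using False by (simp add: mult.commute dvd_power mult_dvd_mono dvd_mult)
    ultimately have "p ^ Suc k dvd a - q * (r + p ^ k * s)\<^sup>2" by (metis dvd_diff)
    moreover have "p dvd (r - 1) + p ^ k * s"
      using r False by (intro dvd_add dvd_mult2 dvd_power) auto
    then have "p dvd r + p ^ k * s - 1" by (simp add: algebra_simps)
    ultimately show ?thesis by blast
  qed
qed

section \<open>Transvections and the choice of a pivot\<close>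

text \<open>The identity plus the rank one matrix \<open>u w^T\<close>, a transvection as soon as
  \<open>w\<close> annihilates \<open>u\<close>. With \<open>w\<close> a unit vector it alters one
  basis vector; with \<open>u\<close> a unit vector it adds multiples of one basis vector to
  others.\<close>

definition shear :: "nat \<Rightarrow> (nat \<Rightarrow> int) \<Rightarrow> (nat \<Rightarrow> int) \<Rightarrow> int mat" where
  "shear n u w = mat n n (\<lambda>(i, j). (if i = j then 1 else 0) + u i * w j)"

lemma shear_carrier [simp]: "shear n u w \<in> carrier_mat n n"
  by (simp add: shear_def)

lemma shear_mult:
  assumes "(\<Sum>k<n. w k * u k) = 0"
  shows "shear n u w * shear n (\<lambda>i. - u i) w = 1\<^sub>m n"
proof (rule eq_matI)
  fix i j assume ij: "i < dim_row (1\<^sub>m n :: int mat)" "j < dim_col (1\<^sub>m n :: int mat)"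
  have "(shear n u w * shear n (\<lambda>i. - u i) w) $$ (i, j) =
     (\<Sum>k<n. ((if i = k then 1 else 0) + u i * w k) * ((if k = j then 1 else 0) - u k * w j))"
    using ij by (auto simp: shear_def scalar_prod_def atLeast0LessThan intro!: sum.cong)
  also have "\<dots> = (\<Sum>k<n. (if i = k then (if k = j then 1 else 0) - u k * w j else 0)
     + (if k = j then u i * w k else 0) - u i * w j * (w k * u k))"
    by (intro sum.cong) (auto simp: algebra_simps)
  also have "\<dots> = (if i = j then 1 else 0)"
    using ij assms by (simp add: sum.distrib sum_subtractf sum_distrib_left[symmetric])
  finally show "(shear n u w * shear n (\<lambda>i. - u i) w) $$ (i, j) = 1\<^sub>m n $$ (i, j)"
    using ij by simp
qed (auto simp: shear_def)

lemma invertible_shear: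
  assumes "(\<Sum>k<n. w k * u k) = 0"
  shows "invertible_mat (shear n u w)"
  using shear_mult[OF assms] shear_mult[where u = "\<lambda>i. - u i" and w = w and n = n] assms
  by (intro invertible_matI[of _ n "shear n (\<lambda>i. - u i) w"]) (auto simp: sum_negf)

lemma index_triple_mult:
  fixes E B F :: "int mat"
  assumes "E \<in> carrier_mat n n" "B \<in> carrier_mat n n" "F \<in> carrier_mat n n" "i < n" "j < n"
  shows "(E * B * F) $$ (i, j) = (\<Sum>b<n. (\<Sum>a<n. E $$ (i, a) * B $$ (a, b)) * F $$ (b, j))"
  using assms by (auto simp: scalar_prod_def atLeast0LessThan simp del: assoc_mult_mat)

text \<open>Here \<open>\<beta> = B u\<close>; the formula is the expansion of
  \<open>(I + w u^T) B (I + u w^T)\<close>, with the symmetry of \<open>B\<close> identifying the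
  two mixed terms.\<close>

lemma shear_congruence:
  fixes B :: "int mat"
  assumes B: "B \<in> carrier_mat n n" and sym: "\<And>i j. i < n \<Longrightarrow> j < n \<Longrightarrow> B $$ (i, j) = B $$ (j, i)"
    and ij: "i < n" "j < n"
    and \<beta>: "\<And>j. j < n \<Longrightarrow> \<beta> j = (\<Sum>k<n. B $$ (j, k) * u k)"
  shows "((shear n u w)\<^sup>T * B * shear n u w) $$ (i, j) =
    B $$ (i, j) + w i * \<beta> j + w j * \<beta> i + w i * w j * (\<Sum>k<n. u k * \<beta> k)"
proof -
  have inner: "(\<Sum>a<n. (shear n u w)\<^sup>T $$ (i, a) * B $$ (a, b)) = B $$ (i, b) + w i * \<beta> b" if b: "b < n" for b
  proof -
    have "(\<Sum>a<n. (shear n u w)\<^sup>T $$ (i, a) * B $$ (a, b)) =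
       (\<Sum>a<n. (if a = i then B $$ (a, b) else 0) + w i * (B $$ (b, a) * u a))"
      using ij b by (intro sum.cong refl) (auto simp: shear_def sym[of _ b] algebra_simps)
    then show ?thesis using ij b by (simp add: sum.distrib sum_distrib_left \<beta>)
  qed
  have "((shear n u w)\<^sup>T * B * shear n u w) $$ (i, j) =
    (\<Sum>b<n. (B $$ (i, b) + w i * \<beta> b) * (shear n u w) $$ (b, j))"
    using B ij inner by (subst index_triple_mult[of _ n]) auto
  also have "\<dots> = (\<Sum>b<n. (if b = j then B $$ (i, b) + w i * \<beta> b else 0) + w j * (B $$ (i, b) * u b)
       + w i * w j * (u b * \<beta> b))"
    using ij by (intro sum.cong refl) (auto simp: shear_def algebra_simps)
  finally show ?thesis using ij by (simp add: sum.distrib sum_distrib_left \<beta>[of i])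
qed

text \<open>The displayed number is the value of the form at \<open>e_t + c\<close>. If
  \<open>q\<close> divided the values at \<open>e_t\<close>, at all \<open>e_t + e_i\<close> and
  \<open>e_t - e_i\<close>, and at all \<open>e_t + e_i + e_j\<close>, polarization would make it
  divide every entry of the block, since 2 is prime to the odd \<open>q\<close>. The support of
  \<open>c\<close> beyond \<open>t\<close> makes the replacement of \<open>e_t\<close> by
  \<open>e_t + c\<close> unimodular.\<close>

lemma pivot_vector:
  fixes b :: "nat \<Rightarrow> nat \<Rightarrow> int" and q :: int
  assumes sym: "\<And>i j. i < n \<Longrightarrow> j < n \<Longrightarrow> b i j = b j i" and odd: "odd q"
    and T: "t < n" "t \<le> i" "i < n" "t \<le> j" "j < n" and nd: "\<not> q dvd b i j"
  shows "\<exists>c. (\<forall>k. k \<le> t \<or> k \<ge> n \<longrightarrow> c k = 0) \<and>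
    \<not> q dvd b t t + 2 * (\<Sum>k<n. b t k * c k) + (\<Sum>k<n. c k * (\<Sum>m<n. b k m * c m))"
proof -
  let ?P = "\<lambda>c. (\<forall>k. k \<le> t \<or> k \<ge> n \<longrightarrow> c k = 0) \<and>
    \<not> q dvd b t t + 2 * (\<Sum>k<n. b t k * c k) + (\<Sum>k<n. c k * (\<Sum>m<n. b k m * c m))"
  have half: "q dvd x" if "q dvd 2 * x" for x
    using that odd by (simp add: coprime_dvd_mult_right_iff)
  have two: "(\<exists>c. ?P c)" if i: "t < i" "i < n" and nd: "\<not> (q dvd b t t + 2 * b t i + b i i \<and> q dvd b t t - 2 * b t i + b i i)" for i
  proof -
    \<comment> \<open>The candidate is \<open>e_t + s * e_i\<close>, used with \<open>s = 1\<close>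
      and \<open>s = - 1\<close>: the two values have difference \<open>4 * b t i\<close> and sum
      \<open>2 * (b t t + b i i)\<close>.\<close>
    have *: "?P (\<lambda>k. if k = i then s else 0) \<longleftrightarrow> \<not> q dvd b t t + 2 * (b t i * s) + s * (b i i * s)" for s
      using i by (auto simp: if_distrib[of "\<lambda>x. _ * x"] if_distrib[of "\<lambda>x. x * _"] cong: if_cong)
    have "?P (\<lambda>k. if k = i then 1 else 0) \<or> ?P (\<lambda>k. if k = i then - 1 else 0)"
      unfolding * using nd by auto
    then show ?thesis by (elim disjE) (rule exI, assumption)+
  qed
  consider "\<not> q dvd b t t" | k where "q dvd b t t" "t < k" "k < n" "\<not> q dvd b t k \<or> \<not> q dvd b k k"
    | "q dvd b t t" "\<And>k. t < k \<Longrightarrow> k < n \<Longrightarrow> q dvd b t k \<and> q dvd b k k" by blast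
  then show ?thesis
  proof cases
    case 1
    then show ?thesis by (intro exI[of _ "\<lambda>_. 0"]) auto
  next
    case 2
    show ?thesis
    proof (rule two[OF 2(2,3)], rule notI, elim conjE)
      assume a: "q dvd b t t + 2 * b t k + b k k" "q dvd b t t - 2 * b t k + b k k"
      have "q dvd 2 * (2 * b t k)" using dvd_diff[OF a] by (simp add: algebra_simps)
      then have tk: "q dvd b t k" using half by blast
      have "q dvd 2 * (b t t + b k k)" using dvd_add[OF a] by (simp add: algebra_simps)
      then have "q dvd b t t + b k k" using half by blast
      then have "q dvd b k k" using 2(1) by (simp add: dvd_add_right_iff)
      then show False using tk 2 by blast
    qed
  next
    case 3
    \<comment> \<open>Only an off-diagonal entry beyond row and column \<open>t\<close> can now
      escape \<open>q\<close>, and \<open>e_t + e_i + e_j\<close> detects it.\<close>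
    have ij: "t < i" "t < j" "i \<noteq> j"
      using 3 nd T sym[OF T(3,1)] by (metis le_neq_implies_less)+
    let ?c = "\<lambda>k. (if k = i then 1 else 0) + (if k = j then 1 else 0)"
    have "b t t + 2 * (\<Sum>k<n. b t k * ?c k) + (\<Sum>k<n. ?c k * (\<Sum>m<n. b k m * ?c m)) =
       (b t t + 2 * (b t i + b t j) + b i i + b j j) + 2 * b i j"
      using T ij sym[OF T(5,3)] by (simp add: distrib_left distrib_right sum.distrib if_distrib[of "\<lambda>x. _ * x"] if_distrib[of "\<lambda>x. x * _"] cong: if_cong)
    moreover have "q dvd b t t + 2 * (b t i + b t j) + b i i + b j j"
      using 3 ij T by (intro dvd_add dvd_mult) auto
    ultimately have "\<not> q dvd b t t + 2 * (\<Sum>k<n. b t k * ?c k) + (\<Sum>k<n. ?c k * (\<Sum>m<n. b k m * ?c m))"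
      using nd half[of "b i j"] by (metis dvd_add_right_iff)
    then show ?thesis using ij T by (intro exI[of _ ?c]) auto
  qed
qed


text \<open>
  Here \<open>e\<close> records the \<open>p\<close>-adic valuations of the pivots; that they divide the remaining block makes
  the later pivots at least as divisible.
\<close>

definition diagonal_upto :: "int \<Rightarrow> nat \<Rightarrow> nat \<Rightarrow> nat \<Rightarrow> int mat \<Rightarrow> nat \<Rightarrow> (nat \<Rightarrow> nat) \<Rightarrow> bool" where
  "diagonal_upto p N k n B t e \<longleftrightarrow>
     B \<in> carrier_mat n n \<and> (\<forall>i<n. \<forall>j<n. B $$ (i, j) = B $$ (j, i)) \<and>
     (\<forall>s<t. \<forall>j<n. j \<noteq> s \<longrightarrow> p ^ N dvd B $$ (s, j)) \<and>
     (\<forall>s<t. p ^ e s dvd B $$ (s, s) \<and> \<not> p ^ Suc (e s) dvd B $$ (s, s) \<and> e s \<le> k) \<and>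
     (\<forall>s<t. \<forall>i\<in>{t..<n}. \<forall>j\<in>{t..<n}. p ^ e s dvd B $$ (i, j)) \<and>
     (\<forall>s'<t. \<forall>s\<le>s'. e s \<le> e s')"

text \<open>Two transvections. The first makes the pivot attain the least \<open>p\<close>-adic
  valuation \<open>m\<close> of the remaining block; the second uses it to clear its row modulo
  \<open>p ^ N\<close>. The matrix \<open>K\<close>, which is \<open>p ^ k\<close> times the inverse
  of \<open>B\<close>, bounds \<open>m\<close> by \<open>k\<close>.\<close>

lemma diagonal_step:
  fixes p :: int
  assumes p: "prime p" "odd p" and D: "diagonal_upto p N k n B t e" and t: "t < n"
    and K: "K \<in> carrier_mat n n" "B * K = p ^ k \<cdot>\<^sub>m 1\<^sub>m n" and N: "k < N"
  shows "\<exists>E e'. E \<in> carrier_mat n n \<and> invertible_mat E \<and> diagonal_upto p N k n (E\<^sup>T * B * E) (Suc t) e'"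
proof -
  have B: "B \<in> carrier_mat n n" and sym: "\<And>i j. i < n \<Longrightarrow> j < n \<Longrightarrow> B $$ (i, j) = B $$ (j, i)"
    and off: "\<And>s j. s < t \<Longrightarrow> j < n \<Longrightarrow> j \<noteq> s \<Longrightarrow> p ^ N dvd B $$ (s, j)"
    and dg: "\<And>s. s < t \<Longrightarrow> p ^ e s dvd B $$ (s, s) \<and> \<not> p ^ Suc (e s) dvd B $$ (s, s) \<and> e s \<le> k"
    and rest: "\<And>s i j. s < t \<Longrightarrow> t \<le> i \<Longrightarrow> i < n \<Longrightarrow> t \<le> j \<Longrightarrow> j < n \<Longrightarrow> p ^ e s dvd B $$ (i, j)"
    and mono: "\<And>s s'. s' < t \<Longrightarrow> s \<le> s' \<Longrightarrow> e s \<le> e s'"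
    using D unfolding diagonal_upto_def by auto
  have p0: "p \<noteq> 0" "\<not> is_unit p" using p(1) not_prime_unit by auto
  \<comment> \<open>The least \<open>m\<close> with this property is the minimal valuation in the
    remaining block.\<close>
  let ?Q = "\<lambda>m. \<exists>i j. t \<le> i \<and> i < n \<and> t \<le> j \<and> j < n \<and> \<not> p ^ Suc m dvd B $$ (i, j)"
  \<comment> \<open>Otherwise \<open>p ^ Suc k\<close> would divide the whole row \<open>t\<close>,
    hence the entry \<open>p ^ k\<close> of \<open>B * K\<close>.\<close>
  have Qk: "?Q k"
  proof (rule ccontr)
    assume "\<not> ?Q k"
    then have all: "p ^ Suc k dvd B $$ (t, j)" if "j < n" for j
      using that t off[of j t] sym[of t j] le_imp_power_dvd[of "Suc k" N p] N
      by (cases "t \<le> j") (auto intro: dvd_trans)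
    have "p ^ k = (B * K) $$ (t, t)" using t unfolding K(2) by simp
    also have "\<dots> = (\<Sum>j<n. B $$ (t, j) * K $$ (j, t))"
      using B K(1) t by (simp add: scalar_prod_def atLeast0LessThan del: K)
    also have "p ^ Suc k dvd \<dots>" using all by (intro dvd_sum) auto
    finally show False using p0 by (simp add: dvd_mult_cancel_right)
  qed
  define m where "m = (LEAST m. ?Q m)"
  have Qm: "?Q m" unfolding m_def using Qk by (rule LeastI)
  have mk: "m \<le> k" unfolding m_def using Qk by (rule Least_le)
  have pm: "p ^ m dvd B $$ (i, j)" if "t \<le> i" "i < n" "t \<le> j" "j < n" for i j
  proof (cases m)
    case (Suc m')
    then have "\<not> ?Q m'" using not_less_Least[of m' ?Q] by (simp add: m_def)
    then show ?thesis using that Suc by auto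
  qed simp
  \<comment> \<open>The pivot valuations cannot decrease, because \<open>p ^ e s\<close> divides the
    whole remaining block.\<close>
  have em: "e s \<le> m" if "s < t" for s
  proof (rule ccontr)
    assume "\<not> e s \<le> m"
    then have "p ^ Suc m dvd p ^ e s" by (intro le_imp_power_dvd) simp
    then show False using Qm rest[OF that] dvd_trans by blast
  qed
  obtain i0 j0 where ij0: "t \<le> i0" "i0 < n" "t \<le> j0" "j0 < n" "\<not> p ^ Suc m dvd B $$ (i0, j0)"
    using Qm by blast
  obtain c where c0: "\<And>k. k \<le> t \<or> k \<ge> n \<Longrightarrow> c k = 0"
    and c: "\<not> p ^ Suc m dvd B $$ (t, t) + 2 * (\<Sum>k<n. B $$ (t, k) * c k) +
        (\<Sum>k<n. c k * (\<Sum>m<n. B $$ (k, m) * c m))"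
    using pivot_vector[of n "\<lambda>i j. B $$ (i, j)" "p ^ Suc m" t i0 j0] sym p(2) t ij0 by auto
  \<comment> \<open>With \<open>w = e_t\<close>, the matrix \<open>F\<close> replaces the basis
    vector \<open>e_t\<close> by \<open>e_t + c\<close>, and \<open>E\<close> below adds
    \<open>x j * e_t\<close> to each later \<open>e_j\<close>.\<close>
  define w where "w i = (if i = t then 1 else 0 :: int)" for i
  define F where "F = shear n c w"
  define \<beta> where "\<beta> j = (\<Sum>k<n. B $$ (j, k) * c k)" for j
  define B1 where "B1 = F\<^sup>T * B * F"
  have F: "F \<in> carrier_mat n n" "invertible_mat F"
    unfolding F_def by (auto intro!: invertible_shear sum.neutral simp: w_def c0)
  have B1: "B1 \<in> carrier_mat n n" using F B by (simp add: B1_def)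
  have B1e: "B1 $$ (i, j) = B $$ (i, j) + w i * \<beta> j + w j * \<beta> i + w i * w j * (\<Sum>k<n. c k * \<beta> k)"
    if "i < n" "j < n" for i j
    unfolding B1_def F_def using B sym that by (rule shear_congruence) (auto simp: \<beta>_def)
  have sym1: "B1 $$ (i, j) = B1 $$ (j, i)" if "i < n" "j < n" for i j
    using that by (simp add: B1e sym[of i j])
  have \<beta>N: "p ^ N dvd \<beta> s" if "s < t" for s
    unfolding \<beta>_def
  proof (rule dvd_sum)
    fix k assume "k \<in> {..<n}"
    then show "p ^ N dvd B $$ (s, k) * c k"
      using off[OF that, of k] c0[of k] that by (cases "k \<le> t") auto
  qed
  have \<beta>r: "q dvd \<beta> i" if "t \<le> i" "i < n" "\<And>j. t \<le> j \<Longrightarrow> j < n \<Longrightarrow> q dvd B $$ (i, j)" for i q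
    unfolding \<beta>_def
  proof (rule dvd_sum)
    fix k assume "k \<in> {..<n}"
    then show "q dvd B $$ (i, k) * c k"
      using that(3)[of k] c0[of k] by (cases "k \<le> t") auto
  qed
  have \<gamma>r: "q dvd (\<Sum>k<n. c k * \<beta> k)" if "\<And>i j. t \<le> i \<Longrightarrow> i < n \<Longrightarrow> t \<le> j \<Longrightarrow> j < n \<Longrightarrow> q dvd B $$ (i, j)" for q
  proof (rule dvd_sum)
    fix k assume "k \<in> {..<n}"
    then show "q dvd c k * \<beta> k"
      using \<beta>r[of k q] that c0[of k] by (cases "k \<le> t") auto
  qed
  have off1: "p ^ N dvd B1 $$ (s, j)" if "s < t" "j < n" "j \<noteq> s" for s j
    using that t off[OF that] \<beta>N[OF that(1)] by (simp add: B1e w_def)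
  have dg1: "B1 $$ (s, s) = B $$ (s, s)" if "s < t" for s
    using that t by (simp add: B1e w_def)
  have rest1: "q dvd B1 $$ (i, j)"
    if q: "\<And>i j. t \<le> i \<Longrightarrow> i < n \<Longrightarrow> t \<le> j \<Longrightarrow> j < n \<Longrightarrow> q dvd B $$ (i, j)"
      and ij: "t \<le> i" "i < n" "t \<le> j" "j < n" for q i j
    using \<beta>r[OF ij(1,2) q] \<beta>r[OF ij(3,4) q] \<gamma>r[OF q] q[OF ij] ij
    unfolding B1e[OF ij(2,4)] by (intro dvd_add dvd_mult) auto
  have piv: "\<not> p ^ Suc m dvd B1 $$ (t, t)"
    using c t by (simp add: B1e w_def \<beta>_def algebra_simps)
  obtain a where a: "B1 $$ (t, t) = p ^ m * a" using rest1[OF pm, of t t] t by (auto elim: dvdE)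
  have "\<not> p dvd a" using piv a by auto
  then have "coprime a (p ^ N)" using p(1) by (metis coprime_commute coprime_power_right_iff prime_imp_coprime)
  then obtain v where "[a * v = 1] (mod p ^ N)" using cong_solve_coprime_int by blast
  then have v: "p ^ N dvd a * v - 1" by (simp add: cong_iff_dvd_diff)
  \<comment> \<open>Elimination with the pivot \<open>p ^ m * a\<close>: exact division by
    \<open>p ^ m\<close>, and division by the unit \<open>a\<close> through its inverse
    \<open>v\<close> modulo \<open>p ^ N\<close>.\<close>
  define x where "x j = (if t < j then - (v * (B1 $$ (t, j) div p ^ m)) else 0)" for j
  have clear: "p ^ N dvd B1 $$ (t, j) + x j * B1 $$ (t, t)" if "t < j" "j < n" for j
  proof -
    have "p ^ m dvd B1 $$ (t, j)" using rest1[OF pm, of t j] that t by auto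
    then obtain b where b: "B1 $$ (t, j) = p ^ m * b" by (auto elim: dvdE)
    have "B1 $$ (t, j) + x j * B1 $$ (t, t) = - (p ^ m * b) * (a * v - 1)"
      using that p0 by (simp add: x_def b a algebra_simps)
    then show ?thesis using v by simp
  qed
  define E where "E = shear n w x"
  have E: "E \<in> carrier_mat n n" "invertible_mat E"
    unfolding E_def by (auto intro!: invertible_shear sum.neutral simp: w_def x_def)
  define B2 where "B2 = E\<^sup>T * B1 * E"
  have B2: "B2 \<in> carrier_mat n n" using E B1 by (simp add: B2_def)
  have B2e: "B2 $$ (i, j) = B1 $$ (i, j) + x i * B1 $$ (j, t) + x j * B1 $$ (i, t) + x i * x j * B1 $$ (t, t)"
    if "i < n" "j < n" for i j
  proof -
    have "(\<Sum>k<n. w k * B1 $$ (k, t)) = B1 $$ (t, t)"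
      using t by (simp add: w_def if_distrib[of "\<lambda>x. x * _"] cong: if_cong)
    moreover have "(\<Sum>k<n. B1 $$ (j, k) * w k) = B1 $$ (j, t)" for j
      using t by (simp add: w_def if_distrib[of "\<lambda>x. _ * x"] cong: if_cong)
    ultimately show ?thesis
      unfolding B2_def E_def using shear_congruence[OF B1 sym1 that, of "\<lambda>j. B1 $$ (j, t)" w x] by simp
  qed
  have B2B: "B2 = (F * E)\<^sup>T * B * (F * E)"
    using F E B by (simp add: B2_def B1_def transpose_mult[of _ n n] assoc_mult_mat[of _ n n _ n _ n]
        mult_carrier_mat[of _ n n _ n])
  have sym2: "B2 $$ (i, j) = B2 $$ (j, i)" if "i < n" "j < n" for i j
    using that by (simp add: B2e sym1[of i j])
  have rest2: "q dvd B2 $$ (i, j)"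
    if q: "\<And>i j. t \<le> i \<Longrightarrow> i < n \<Longrightarrow> t \<le> j \<Longrightarrow> j < n \<Longrightarrow> q dvd B $$ (i, j)"
      and ij: "t \<le> i" "i < n" "t \<le> j" "j < n" for q i j
    unfolding B2e[OF ij(2,4)] using ij t rest1[OF q] by (intro dvd_add dvd_mult) auto
  have tt2: "B2 $$ (t, t) = B1 $$ (t, t)" using t by (simp add: B2e x_def)
  \<comment> \<open>In an earlier row \<open>s\<close> the clearing only adds multiples of the entry
    at \<open>(s, t)\<close>, which \<open>p ^ N\<close> already divides.\<close>
  have off2: "p ^ N dvd B2 $$ (s, j)" if "s \<le> t" "j < n" "j \<noteq> s" for s j
  proof -
    consider "s < t" | "s = t" "j < t" | "s = t" "t < j" using \<open>s \<le> t\<close> \<open>j \<noteq> s\<close> by linarith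
    then show ?thesis
    proof cases
      case 1
      then show ?thesis using that t off1[OF 1, of j] off1[OF 1, of t] by (simp add: B2e x_def)
    next
      case 2
      then show ?thesis using that t off1[of j t] sym1[of j t] by (simp add: B2e x_def)
    next
      case 3
      then show ?thesis using that t clear[of j] by (simp add: B2e) (simp add: x_def)
    qed
  qed
  have dg2: "B2 $$ (s, s) = B $$ (s, s)" if "s < t" for s
    using that t dg1[OF that] by (simp add: B2e x_def)
  have "diagonal_upto p N k n B2 (Suc t) (e(t := m))"
    unfolding diagonal_upto_def
  proof (intro conjI allI impI ballI)
    fix s assume s: "s < Suc t"
    show "p ^ (e(t := m)) s dvd B2 $$ (s, s)" "\<not> p ^ Suc ((e(t := m)) s) dvd B2 $$ (s, s)" "(e(t := m)) s \<le> k"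
      using s dg2[of s] dg[of s] tt2 piv a mk by (auto simp: less_Suc_eq)
    show "p ^ (e(t := m)) s dvd B2 $$ (i, j)" if "i \<in> {Suc t..<n}" "j \<in> {Suc t..<n}" for i j
      using rest2[OF rest, of s i j] rest2[OF pm, of i j] that s by (cases "s = t") auto
  next
    fix s s' assume "s' < Suc t" "s \<le> s'"
    then show "(e(t := m)) s \<le> (e(t := m)) s'" using mono[of s' s] em[of s] by auto
  qed (use B2 sym2 off2 in auto)
  then show ?thesis
    using B2B F E invertible_mat_mult[OF F E] by (metis mult_carrier_mat)
qed

lemma diagonalize_mod:
  fixes p :: int
  assumes p: "prime p" "odd p" and G: "G \<in> carrier_mat n n" "G\<^sup>T = G"
    and K: "K \<in> carrier_mat n n" "G * K = p ^ k \<cdot>\<^sub>m 1\<^sub>m n" and N: "k < N"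
  shows "\<exists>P e. P \<in> carrier_mat n n \<and> invertible_mat P \<and> diagonal_upto p N k n (P\<^sup>T * G * P) n e"
proof -
  have "\<exists>P e. P \<in> carrier_mat n n \<and> invertible_mat P \<and> diagonal_upto p N k n (P\<^sup>T * G * P) t e" if "t \<le> n" for t
    using that
  proof (induction t)
    case 0
    have "G $$ (i, j) = G $$ (j, i)" if "i < n" "j < n" for i j
      using that G by (metis carrier_matD index_transpose_mat(1))
    then show ?case
      using G by (intro exI[of _ "1\<^sub>m n"]) (auto simp: diagonal_upto_def intro: invertible_matI[of _ n "1\<^sub>m n"])
  next
    case (Suc t)
    then obtain P e where P: "P \<in> carrier_mat n n" "invertible_mat P"
      and D: "diagonal_upto p N k n (P\<^sup>T * G * P) t e" by auto
    obtain X where X: "X * P = 1\<^sub>m n" "X \<in> carrier_mat n n" "P * X = 1\<^sub>m n"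
      using invertible_matE[OF P(2,1)] .
    \<comment> \<open>For the transformed matrix, \<open>X * K * X\<^sup>T\<close> with
      \<open>X\<close> the inverse of \<open>P\<close> takes over the part of \<open>K\<close>, so
      the bound on the valuations persists through the iteration.\<close>
    have "(P\<^sup>T * G * P) * (X * K * X\<^sup>T) = P\<^sup>T * (G * ((P * X) * K)) * X\<^sup>T"
      using P G X(2) K(1) by (simp add: assoc_mult_mat[of _ n n _ n _ n] mult_carrier_mat[of _ n n _ n])
    also have "\<dots> = p ^ k \<cdot>\<^sub>m (X * P)\<^sup>T"
      using P G X(2,3) K by (simp add: transpose_mult[of _ n n] mult_smult_distrib[of _ n n _ n]
        mult_smult_assoc_mat[of _ n n _ n])
    finally have "(P\<^sup>T * G * P) * (X * K * X\<^sup>T) = p ^ k \<cdot>\<^sub>m 1\<^sub>m n" using X(1) by simp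
    from diagonal_step[OF p D _ _ this N] Suc.prems X K
    obtain E e' where E: "E \<in> carrier_mat n n" "invertible_mat E"
      and D': "diagonal_upto p N k n (E\<^sup>T * (P\<^sup>T * G * P) * E) (Suc t) e'" by auto
    have "E\<^sup>T * (P\<^sup>T * G * P) * E = (P * E)\<^sup>T * G * (P * E)"
      using P E G by (simp add: transpose_mult[of _ n n] assoc_mult_mat[of _ n n _ n _ n]
        mult_carrier_mat[of _ n n _ n])
    then show ?case using D' P E invertible_mat_mult[OF P E] by (metis mult_carrier_mat)
  qed
  then show ?thesis by blast
qed


section \<open>From the diagonal form modulo a prime power to the Smith form\<close>

text \<open>Determinants give \<open>det A \<noteq> 0\<close>. Multiplication by the adjugate then
  cancels \<open>A\<close> up to the factor \<open>det A\<close>, all within the integers.\<close>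

lemma scalar_inverse_commute:
  fixes A B :: "int mat"
  assumes A: "A \<in> carrier_mat n n" and B: "B \<in> carrier_mat n n" and AB: "A * B = c \<cdot>\<^sub>m 1\<^sub>m n" and c: "c \<noteq> 0"
  shows "B * A = c \<cdot>\<^sub>m 1\<^sub>m n"
proof -
  have "det A * det B = c ^ n"
    using det_mult[OF A B] by (simp add: AB det_smult)
  then have d: "det A \<noteq> 0" using c by auto
  have "det A \<cdot>\<^sub>m (B * A) = (det A \<cdot>\<^sub>m 1\<^sub>m n) * (B * A)"
    using A B by (simp add: mult_smult_assoc_mat[of _ n n _ n] mult_carrier_mat[of _ n n _ n])
  also have "\<dots> = adj_mat A * ((A * B) * A)"
    unfolding adj_mat(3)[OF A, symmetric] using adj_mat(1)[OF A] A B
    by (simp add: assoc_mult_mat[of _ n n _ n _ n] mult_carrier_mat[of _ n n _ n])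
  also have "\<dots> = c \<cdot>\<^sub>m (adj_mat A * A)"
    unfolding AB using adj_mat(1)[OF A] A by (simp add: mult_smult_assoc_mat[of _ n n _ n] mult_smult_distrib[of _ n n _ n])
  also have "\<dots> = det A \<cdot>\<^sub>m (c \<cdot>\<^sub>m 1\<^sub>m n)"
    unfolding adj_mat(3)[OF A] by (intro eq_matI) auto
  finally have eq: "det A \<cdot>\<^sub>m (B * A) = det A \<cdot>\<^sub>m (c \<cdot>\<^sub>m 1\<^sub>m n)" .
  show ?thesis
  proof (rule eq_matI)
    fix i j assume "i < dim_row (c \<cdot>\<^sub>m 1\<^sub>m n)" "j < dim_col (c \<cdot>\<^sub>m 1\<^sub>m n)"
    then have ij: "i < n" "j < n" by auto
    have "(det A \<cdot>\<^sub>m (B * A)) $$ (i, j) = (det A \<cdot>\<^sub>m (c \<cdot>\<^sub>m 1\<^sub>m n)) $$ (i, j)" using eq by simp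
    then have "det A * (B * A) $$ (i, j) = det A * (c \<cdot>\<^sub>m 1\<^sub>m n) $$ (i, j)"
      using ij A B by (metis carrier_matD index_smult_mat(1,2,3) index_mult_mat(2,3) index_one_mat(2,3))
    then show "(B * A) $$ (i, j) = (c \<cdot>\<^sub>m 1\<^sub>m n) $$ (i, j)" using d by simp
  qed (use A B in auto)
qed

text \<open>Modulo \<open>p\<close> the matrix \<open>S\<close> is diagonal with unit entries, so
  \<open>S * X = p ^ k\<close> with positive \<open>k\<close> forces \<open>p\<close> to divide
  \<open>X\<close>. Dividing \<open>X\<close> by \<open>p\<close> lowers \<open>k\<close>, and at
  \<open>k = 0\<close> the matrix \<open>X\<close> is an inverse.\<close>

lemma invertible_of_diagonal_mod:
  fixes S X :: "int mat"
  assumes p: "prime p" and S: "S \<in> carrier_mat n n" and X: "X \<in> carrier_mat n n"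
    and SX: "S * X = p ^ k \<cdot>\<^sub>m 1\<^sub>m n"
    and off: "\<And>i j. i < n \<Longrightarrow> j < n \<Longrightarrow> i \<noteq> j \<Longrightarrow> p dvd S $$ (i, j)"
    and dg: "\<And>i. i < n \<Longrightarrow> \<not> p dvd S $$ (i, i)"
  shows "invertible_mat S"
  using X SX
proof (induction k arbitrary: X)
  case 0
  then have "S * X = 1 \<cdot>\<^sub>m 1\<^sub>m n" by simp
  from this scalar_inverse_commute[OF S 0(1) this] show ?case
    using 0(1) S by (intro invertible_matI[of _ n X]) auto
next
  case (Suc k)
  have entry: "(\<Sum>m<n. S $$ (i, m) * X $$ (m, j)) = p ^ Suc k * (if i = j then 1 else 0)"
    if "i < n" "j < n" for i j
  proof -
    have "(S * X) $$ (i, j) = (\<Sum>m<n. S $$ (i, m) * X $$ (m, j))"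
      using that S Suc.prems(1) by (simp add: scalar_prod_def atLeast0LessThan)
    then show ?thesis using that unfolding Suc.prems(2) by simp
  qed
  have pX: "p dvd X $$ (i, j)" if ij: "i < n" "j < n" for i j
  proof -
    have "(\<Sum>m<n. S $$ (i, m) * X $$ (m, j)) =
      S $$ (i, i) * X $$ (i, j) + (\<Sum>m\<in>{..<n} - {i}. S $$ (i, m) * X $$ (m, j))"
      using ij by (intro sum.remove) auto
    moreover have "p dvd (\<Sum>m\<in>{..<n} - {i}. S $$ (i, m) * X $$ (m, j))"
      using ij off by (intro dvd_sum) auto
    moreover have "p dvd (\<Sum>m<n. S $$ (i, m) * X $$ (m, j))"
      unfolding entry[OF ij] by simp
    ultimately have "p dvd S $$ (i, i) * X $$ (i, j)" by (simp add: dvd_add_left_iff)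
    then show ?thesis using p dg[OF ij(1)] by (simp add: prime_dvd_mult_iff)
  qed
  define Y where "Y = mat n n (\<lambda>ij. X $$ ij div p)"
  have Y: "p * Y $$ (i, j) = X $$ (i, j)" if "i < n" "j < n" for i j
    using pX[OF that] that by (simp add: Y_def)
  have "S * Y = p ^ k \<cdot>\<^sub>m 1\<^sub>m n"
  proof (rule eq_matI)
    fix i j assume "i < dim_row (p ^ k \<cdot>\<^sub>m 1\<^sub>m n)" "j < dim_col (p ^ k \<cdot>\<^sub>m 1\<^sub>m n)"
    then have ij: "i < n" "j < n" by auto
    have "p * (S * Y) $$ (i, j) = (\<Sum>m<n. S $$ (i, m) * (p * Y $$ (m, j)))"
      using S ij by (simp add: Y_def scalar_prod_def atLeast0LessThan sum_distrib_left mult.left_commute)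
    also have "\<dots> = p * (p ^ k * (if i = j then 1 else 0))"
      using entry[OF ij] ij Y by simp
    finally show "(S * Y) $$ (i, j) = (p ^ k \<cdot>\<^sub>m 1\<^sub>m n) $$ (i, j)" using ij p by auto
  qed (use S in \<open>auto simp: Y_def\<close>)
  then show ?case by (intro Suc.IH[of Y]) (auto simp: Y_def)
qed

text \<open>Moving the unimodular \<open>S\<close> to the other side, the transformations
  \<open>S^-1 P^T\<close> and \<open>P\<close> bring \<open>G\<close> to diagonal form.\<close>

lemma smith_diagonalI:
  assumes G: "G \<in> carrier_mat n n" and P: "P \<in> carrier_mat n n" "invertible_mat P"
    and S: "S \<in> carrier_mat n n" "invertible_mat S"
    and eq: "P\<^sup>T * G * P = S * mat_diag n (\<lambda>i. int (d i))"
    and chain: "\<And>i. Suc i < n \<Longrightarrow> d i dvd d (Suc i)"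
  shows "smith_diagonal G (map d [0..<n])"
proof -
  obtain X where X: "X * P = 1\<^sub>m n" "X \<in> carrier_mat n n" "P * X = 1\<^sub>m n"
    using invertible_matE[OF P(2,1)] .
  obtain T where T: "T * S = 1\<^sub>m n" "T \<in> carrier_mat n n" "S * T = 1\<^sub>m n"
    using invertible_matE[OF S(2,1)] .
  have "X\<^sup>T * P\<^sup>T = 1\<^sub>m n" "P\<^sup>T * X\<^sup>T = 1\<^sub>m n"
    using X P by (simp_all add: transpose_mult[of _ n n, symmetric])
  then have PT: "invertible_mat (P\<^sup>T)" using X P by (intro invertible_matI[of _ n "X\<^sup>T"]) auto
  have TI: "invertible_mat T" using T S by (intro invertible_matI[of _ n S]) auto
  have D: "mat_diag n (\<lambda>i. int (d i)) \<in> carrier_mat n n" by simp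
  have "(T * P\<^sup>T) * G * P = T * (P\<^sup>T * G * P)"
    using T P G by (simp add: assoc_mult_mat[of _ n n _ n _ n] mult_carrier_mat[of _ n n _ n])
  also have "\<dots> = (T * S) * mat_diag n (\<lambda>i. int (d i))"
    unfolding eq using T(2) S(1) D by (simp add: assoc_mult_mat[of _ n n _ n _ n])
  also have "\<dots> = mat_diag n (\<lambda>i. int (map d [0..<n] ! i))"
    unfolding T(1) using D by (simp add: mat_diag_def) (intro eq_matI, auto)
  finally have "(T * P\<^sup>T) * G * P = mat_diag n (\<lambda>i. int (map d [0..<n] ! i))" .
  moreover have "invertible_mat (T * P\<^sup>T)"
    using TI PT T P by (intro invertible_mat_mult[of _ n]) auto
  ultimately have "\<exists>P'\<in>carrier_mat n n. \<exists>Q\<in>carrier_mat n n. invertible_mat P' \<and> invertible_mat Q \<and>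
      P' * G * Q = mat_diag n (\<lambda>i. int (map d [0..<n] ! i))"
    using P T(2) by (meson mult_carrier_mat transpose_carrier_mat)
  then show ?thesis unfolding smith_diagonal_def using G chain by auto
qed

lemma int_gram_normal_form:
  fixes l :: nat
  assumes l: "prime l" "odd l" and G: "G \<in> carrier_mat n n" "G\<^sup>T = G"
    and K: "K \<in> carrier_mat n n" "G * K = int l ^ k \<cdot>\<^sub>m 1\<^sub>m n"
  obtains P S e where "P \<in> carrier_mat n n" "invertible_mat P" "S \<in> carrier_mat n n" "invertible_mat S"
    "\<And>i j. i < n \<Longrightarrow> j < n \<Longrightarrow> (P\<^sup>T * G * P) $$ (i, j) = S $$ (i, j) * int l ^ e j"
    "\<And>i. i < n \<Longrightarrow> \<not> int l dvd S $$ (i, i)" "\<And>i. i < n \<Longrightarrow> e i \<le> k"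
    "\<And>i j. i < n \<Longrightarrow> j < n \<Longrightarrow> i \<noteq> j \<Longrightarrow> int l ^ (2 * k) dvd (P\<^sup>T * G * P) $$ (i, j)"
    "smith_diagonal G (map (\<lambda>i. l ^ e i) [0..<n])"
proof -
  let ?p = "int l"
  have p: "prime ?p" "odd ?p" using l by auto
  \<comment> \<open>Precision \<open>2 * k\<close> makes the off-diagonal entries divisible by any
    product of two elementary divisors. The additional factor \<open>l\<close> leaves them divisible
    by \<open>l\<close> after one elementary divisor has been divided out, also when
    \<open>k = 0\<close>.\<close>
  obtain P e where P: "P \<in> carrier_mat n n" "invertible_mat P"
    and D: "diagonal_upto ?p (2 * k + 1) k n (P\<^sup>T * G * P) n e"
    using diagonalize_mod[OF p G K, of "2 * k + 1"] by auto
  define B where "B = P\<^sup>T * G * P"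
  have B: "B \<in> carrier_mat n n"
    and off: "\<And>s j. s < n \<Longrightarrow> j < n \<Longrightarrow> j \<noteq> s \<Longrightarrow> ?p ^ (2 * k + 1) dvd B $$ (s, j)"
    and dg: "\<And>s. s < n \<Longrightarrow> ?p ^ e s dvd B $$ (s, s)" "\<And>s. s < n \<Longrightarrow> \<not> ?p ^ Suc (e s) dvd B $$ (s, s)"
      "\<And>s. s < n \<Longrightarrow> e s \<le> k"
    and mono: "\<And>s s'. s' < n \<Longrightarrow> s \<le> s' \<Longrightarrow> e s \<le> e s'"
    using D unfolding diagonal_upto_def B_def by auto
  have p0: "?p \<noteq> 0" using p by auto
  have offd: "?p ^ Suc (e j) dvd B $$ (i, j)" if "i < n" "j < n" "i \<noteq> j" for i j
    using off[of i j] that dg(3)[of j] le_imp_power_dvd[of "Suc (e j)" "2 * k + 1" ?p] by (auto intro: dvd_trans)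
  define S where "S = mat n n (\<lambda>(i, j). B $$ (i, j) div ?p ^ e j)"
  have S: "B $$ (i, j) = S $$ (i, j) * ?p ^ e j" if "i < n" "j < n" for i j
  proof -
    have "?p ^ e j dvd B $$ (i, j)"
      using offd[OF that] dg(1)[of j] that by (cases "i = j") (auto intro: dvd_trans[OF le_imp_power_dvd])
    then show ?thesis using that by (simp add: S_def)
  qed
  have Sc: "S \<in> carrier_mat n n" by (simp add: S_def)
  have offS: "?p dvd S $$ (i, j)" if "i < n" "j < n" "i \<noteq> j" for i j
    using offd[OF that] S[OF that(1,2)] p0 by (simp add: dvd_mult_cancel_right)
  have dgS: "\<not> ?p dvd S $$ (i, i)" if "i < n" for i
    using dg(2)[OF that] S[OF that that] p0 by (simp add: mult.commute)
  have BS: "B = S * mat_diag n (\<lambda>i. int (l ^ e i))"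
    unfolding mat_diag_mult_right[OF Sc] using B S by (intro eq_matI) auto
  obtain X where X: "X * P = 1\<^sub>m n" "X \<in> carrier_mat n n" "P * X = 1\<^sub>m n"
    using invertible_matE[OF P(2,1)] .
  have "B * (X * K * X\<^sup>T) = P\<^sup>T * (G * ((P * X) * K)) * X\<^sup>T"
    using P G X(2) K(1) by (simp add: B_def assoc_mult_mat[of _ n n _ n _ n] mult_carrier_mat[of _ n n _ n])
  also have "\<dots> = ?p ^ k \<cdot>\<^sub>m (X * P)\<^sup>T"
    using P G X(2,3) K by (simp add: transpose_mult[of _ n n] mult_smult_distrib[of _ n n _ n]
      mult_smult_assoc_mat[of _ n n _ n])
  finally have "B * (X * K * X\<^sup>T) = ?p ^ k \<cdot>\<^sub>m 1\<^sub>m n" using X(1) by simp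
  then have "S * (mat_diag n (\<lambda>i. int (l ^ e i)) * (X * K * X\<^sup>T)) = ?p ^ k \<cdot>\<^sub>m 1\<^sub>m n"
    unfolding BS using Sc X(2) K(1) by (simp add: assoc_mult_mat[of _ n n _ n _ n] mult_carrier_mat[of _ n n _ n])
  \<comment> \<open>\<open>S\<close> is diagonal with unit entries modulo \<open>l\<close> and
    inherits an inverse up to \<open>l ^ k\<close> from \<open>B\<close>, so it is
    unimodular.\<close>
  then have IS: "invertible_mat S"
    using X(2) K(1) Sc by (intro invertible_of_diagonal_mod[OF p(1) Sc _ _ offS dgS])
      (auto simp: mult_carrier_mat[of _ n n _ n] simp del: assoc_mult_mat)
  have "smith_diagonal G (map (\<lambda>i. l ^ e i) [0..<n])"
    using BS mono by (intro smith_diagonalI[OF G(1) P Sc IS]) (auto simp: B_def intro: le_imp_power_dvd)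
  moreover have "int l ^ (2 * k) dvd B $$ (i, j)" if "i < n" "j < n" "i \<noteq> j" for i j
    using off[of i j] that by (auto intro: dvd_mult_right)
  ultimately show ?thesis
    using that[OF P Sc IS, of e] S dgS dg(3) unfolding B_def by blast
qed


section \<open>Bases, rank and level of a lattice\<close>

text \<open>The witness \<open>K\<close> is \<open>m\<close> times the inverse of \<open>G\<close>;
  requiring it as an integer matrix removes the rational inverse from the notion of level.\<close>

definition level_multiple :: "int mat \<Rightarrow> nat \<Rightarrow> bool" where
  "level_multiple G m \<longleftrightarrow> m > 0 \<and> (\<exists>K \<in> carrier_mat (dim_row G) (dim_row G).
     G * K = int m \<cdot>\<^sub>m 1\<^sub>m (dim_row G) \<and> K * G = int m \<cdot>\<^sub>m 1\<^sub>m (dim_row G) \<and>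
     (\<forall>i<dim_row G. even (K $$ (i, i))))"

lemma level_multiple_iff:
  assumes G: "G \<in> carrier_mat n n" and m: "m > 0"
  shows "(\<exists>H. H \<in> carrier_mat n n \<and> inverts_mat (map_mat rat_of_int G) H \<and>
      inverts_mat H (map_mat rat_of_int G) \<and> integral_even_diag (of_nat m \<cdot>\<^sub>m H)) \<longleftrightarrow> level_multiple G m"
    (is "(\<exists>H. ?P H) \<longleftrightarrow> _")
proof
  let ?G = "map_mat rat_of_int G"
  have GQ: "?G \<in> carrier_mat n n" using G by simp
  have one: "map_mat rat_of_int (int m \<cdot>\<^sub>m 1\<^sub>m n) = of_nat m \<cdot>\<^sub>m 1\<^sub>m n"
    by (intro eq_matI) auto
  {
    assume "\<exists>H. ?P H"
    then obtain H B where H: "H \<in> carrier_mat n n" "?G * H = 1\<^sub>m n" "H * ?G = 1\<^sub>m n"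
      and HB: "of_nat m \<cdot>\<^sub>m H = map_mat rat_of_int B" and ev: "\<forall>i < dim_row B. even (B $$ (i, i))"
      using G unfolding inverts_mat_def integral_even_diag_def by auto
    have "dim_row (of_nat m \<cdot>\<^sub>m H) = dim_row B" "dim_col (of_nat m \<cdot>\<^sub>m H) = dim_col B"
      unfolding HB by simp_all
    then have B: "B \<in> carrier_mat n n" using H(1) by auto
    have "map_mat rat_of_int (G * B) = ?G * (of_nat m \<cdot>\<^sub>m H)"
      unfolding HB using G B by (rule of_int_hom.mat_hom_mult)
    then have "map_mat rat_of_int (G * B) = map_mat rat_of_int (int m \<cdot>\<^sub>m 1\<^sub>m n)"
      unfolding one using GQ H by (simp add: mult_smult_distrib[of _ n n _ n])
    then have GB: "G * B = int m \<cdot>\<^sub>m 1\<^sub>m n" by (rule of_int_hom.mat_hom_inj)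
    have "B * G = int m \<cdot>\<^sub>m 1\<^sub>m n" using scalar_inverse_commute[OF G B GB] m by simp
    then show "level_multiple G m" using GB G B ev m by (auto simp: level_multiple_def)
  }
  assume "level_multiple G m"
  then obtain K where K: "K \<in> carrier_mat n n" "G * K = int m \<cdot>\<^sub>m 1\<^sub>m n" "K * G = int m \<cdot>\<^sub>m 1\<^sub>m n"
    "\<forall>i<n. even (K $$ (i, i))" using G by (auto simp: level_multiple_def)
  let ?K = "map_mat rat_of_int K"
  define H where "H = (1 / of_nat m) \<cdot>\<^sub>m ?K"
  have "?G * ?K = of_nat m \<cdot>\<^sub>m 1\<^sub>m n" "?K * ?G = of_nat m \<cdot>\<^sub>m 1\<^sub>m n"
    using G K by (simp_all add: of_int_hom.mat_hom_mult[symmetric, of _ n n _ n] one)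
  then have "?G * H = 1\<^sub>m n" "H * ?G = 1\<^sub>m n"
    using GQ K(1) m by (simp_all add: H_def mult_smult_distrib[of _ n n _ n] mult_smult_assoc_mat[of _ n n _ n])
      (auto intro!: eq_matI)
  moreover have "of_nat m \<cdot>\<^sub>m H = ?K" using m by (auto simp: H_def intro!: eq_matI)
  ultimately show "\<exists>H. ?P H"
    using G K(1,4) by (intro exI[of _ H]) (auto simp: H_def inverts_mat_def integral_even_diag_def)
qed

lemma lattice_level_eq:
  assumes G: "gram_matrix L \<in> carrier_mat n n"
  shows "lattice_level L = (LEAST m. level_multiple (gram_matrix L) m)"
proof -
  have "(\<lambda>m. m > 0 \<and> (\<exists>H. H \<in> carrier_mat n n \<and> inverts_mat (map_mat rat_of_int (gram_matrix L)) H \<and>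
      inverts_mat H (map_mat rat_of_int (gram_matrix L)) \<and> integral_even_diag (of_nat m \<cdot>\<^sub>m H))) =
      level_multiple (gram_matrix L)"
    using level_multiple_iff[OF G] by (auto simp: fun_eq_iff level_multiple_def)
  then show ?thesis using G by (simp add: lattice_level_def Let_def)
qed

text \<open>Integral matrices with even diagonal are closed under integral combinations. Division
  with remainder of \<open>m\<close> by the least value \<open>a\<close> therefore produces the
  smaller candidate \<open>m mod a\<close>, unless it is zero.\<close>

lemma Least_level_multiple_dvd:
  assumes G: "G \<in> carrier_mat n n" and m: "level_multiple G m"
  shows "(LEAST m. level_multiple G m) dvd m"
proof (rule ccontr)
  define a where "a = (LEAST m. level_multiple G m)"
  assume "\<not> (LEAST m. level_multiple G m) dvd m"
  then have r: "m mod a > 0" by (auto simp: a_def mod_greater_zero_iff_not_dvd)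
  have a: "level_multiple G a" unfolding a_def using m by (rule LeastI)
  obtain K where K: "K \<in> carrier_mat n n" "G * K = int m \<cdot>\<^sub>m 1\<^sub>m n" "\<forall>i<n. even (K $$ (i, i))"
    using m G by (auto simp: level_multiple_def)
  obtain A where A: "A \<in> carrier_mat n n" "G * A = int a \<cdot>\<^sub>m 1\<^sub>m n" "\<forall>i<n. even (A $$ (i, i))" and a0: "a > 0"
    using a G by (auto simp: level_multiple_def)
  define R where "R = K - int (m div a) \<cdot>\<^sub>m A"
  have R: "R \<in> carrier_mat n n" using A(1) unfolding R_def by (intro minus_carrier_mat smult_carrier_mat)
  have "G * R = int m \<cdot>\<^sub>m 1\<^sub>m n - int (m div a) \<cdot>\<^sub>m (int a \<cdot>\<^sub>m 1\<^sub>m n)"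
    unfolding R_def using G K A by (simp add: mult_minus_distrib_mat[of _ n n _ n] mult_smult_distrib[of _ n n _ n])
  also have "\<dots> = int (m mod a) \<cdot>\<^sub>m 1\<^sub>m n"
    by (intro eq_matI) (auto simp: zmod_int zdiv_int minus_div_mult_eq_mod[symmetric] algebra_simps)
  finally have GR: "G * R = int (m mod a) \<cdot>\<^sub>m 1\<^sub>m n" .
  have "level_multiple G (m mod a)"
    unfolding level_multiple_def
    using G R GR r scalar_inverse_commute[OF G R GR] K A by (auto simp: R_def intro!: bexI[of _ R])
  then have "a \<le> m mod a" unfolding a_def by (rule Least_le)
  then show False using a0 by (metis mod_less_divisor not_le)
qed

text \<open>The adjugate is integral, so \<open>2 * \<bar>det G\<bar>\<close> is admissible: the
  factor 2 makes the diagonal even, and the sign of the determinant is moved into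
  \<open>K\<close>.\<close>

lemma level_multiple_exists:
  assumes G: "G \<in> carrier_mat n n" and nd: "\<And>v. v \<in> carrier_vec n \<Longrightarrow> G *\<^sub>v v = 0\<^sub>v n \<Longrightarrow> v = 0\<^sub>v n"
  shows "\<exists>m. level_multiple G m"
proof -
  have d: "det G \<noteq> 0" using nd det_0_iff_vec_prod_zero[OF G] by blast
  define K where "K = (2 * sgn (det G)) \<cdot>\<^sub>m adj_mat G"
  have K: "K \<in> carrier_mat n n" using adj_mat(1)[OF G] by (simp add: K_def)
  have GK: "G * K = int (nat (2 * \<bar>det G\<bar>)) \<cdot>\<^sub>m 1\<^sub>m n"
    unfolding K_def using adj_mat(1,2)[OF G] G
    by (simp add: mult_smult_distrib[of _ n n _ n]) (intro eq_matI, auto simp: abs_sgn)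
  have "level_multiple G (nat (2 * \<bar>det G\<bar>))"
    unfolding level_multiple_def using G K GK d scalar_inverse_commute[OF G K GK] adj_mat(1)[OF G]
    by (auto simp: K_def intro!: bexI[of _ K])
  then show ?thesis ..
qed

section \<open>Coordinates, functionals and the rank\<close>

definition zcomb :: "('a, 'm) zlattice_scheme \<Rightarrow> 'a list \<Rightarrow> int vec \<Rightarrow> 'a" where
  "zcomb L bs v = finsum L (\<lambda>i. v $ i \<odot>\<^bsub>L\<^esub> bs ! i) {..<length bs}"

lemma zbasis_iff: "zbasis L bs \<longleftrightarrow> set bs \<subseteq> carrier L \<and> bij_betw (zcomb L bs) (carrier_vec (length bs)) (carrier L)"
  unfolding zbasis_def zcomb_def by simp

text \<open>The elements of \<open>Hom(L, Z)\<close>. They stand in for the dual lattice without an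
  ambient rational space.\<close>

definition int_functional :: "('a, 'm) zlattice_scheme \<Rightarrow> ('a \<Rightarrow> int) \<Rightarrow> bool" where
  "int_functional L \<phi> \<longleftrightarrow> (\<forall>x\<in>carrier L. \<forall>y\<in>carrier L. \<phi> (x \<oplus>\<^bsub>L\<^esub> y) = \<phi> x + \<phi> y) \<and>
     (\<forall>k. \<forall>x\<in>carrier L. \<phi> (k \<odot>\<^bsub>L\<^esub> x) = k * \<phi> x)"

text \<open>Split off from \<open>zlattice\<close> because functionals and combinations are applied
  to the block module below while its basis and the positivity of its form are still being
  established.\<close>

locale int_module = module int_ring L for L :: "('a, 'm) zlattice_scheme" (structure)
begin

lemma functional_zero: "int_functional L \<phi> \<Longrightarrow> \<phi> \<zero> = 0"
  unfolding int_functional_def by (metis add.r_one add.one_closed add_cancel_right_right)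

lemma functional_zcomb:
  assumes \<phi>: "int_functional L \<phi>" and bs: "set bs \<subseteq> carrier L"
  shows "\<phi> (zcomb L bs v) = (\<Sum>i<length bs. v $ i * \<phi> (bs ! i))"
proof -
  have *: "\<phi> (finsum L (\<lambda>i. v $ i \<odot> bs ! i) A) = (\<Sum>i\<in>A. v $ i * \<phi> (bs ! i))"
    if "finite A" "A \<subseteq> {..<length bs}" for A
    using that
  proof (induction A rule: finite_induct)
    case empty
    then show ?case using functional_zero[OF \<phi>] by simp
  next
    case (insert a A)
    have cl: "bs ! i \<in> carrier L" if "i < length bs" for i using bs that by auto
    have "(\<lambda>i. v $ i \<odot> bs ! i) \<in> A \<rightarrow> carrier L" using insert.prems cl by auto
    then show ?case using insert \<phi> cl unfolding int_functional_def by (simp add: finsum_closed)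
  qed
  show ?thesis unfolding zcomb_def by (rule *) auto
qed

lemma zcomb_closed:
  assumes "set bs \<subseteq> carrier L"
  shows "zcomb L bs v \<in> carrier L"
  unfolding zcomb_def using assms nth_mem by (intro finsum_closed) auto

end

sublocale zlattice \<subseteq> int_module ..

context zlattice
begin

lemma zcomb_add:
  assumes "set bs \<subseteq> carrier L" "v \<in> carrier_vec (length bs)" "w \<in> carrier_vec (length bs)"
  shows "zcomb L bs (v + w) = zcomb L bs v \<oplus> zcomb L bs w"
proof -
  have cl: "bs ! i \<in> carrier L" if "i < length bs" for i using assms(1) that by auto
  have distr: "(a + b) \<odot> x = a \<odot> x \<oplus> b \<odot> x" if "x \<in> carrier L" for a b x
    using smult_l_distr[of a b x] that by simp
  have "zcomb L bs (v + w) = finsum L (\<lambda>i. v $ i \<odot> bs ! i \<oplus> w $ i \<odot> bs ! i) {..<length bs}"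
    unfolding zcomb_def using assms(2,3) cl by (intro finsum_cong') (auto simp: distr)
  also have "\<dots> = zcomb L bs v \<oplus> zcomb L bs w"
    unfolding zcomb_def using cl by (intro finsum_addf) auto
  finally show ?thesis .
qed

lemma zcomb_smult:
  assumes "set bs \<subseteq> carrier L" "v \<in> carrier_vec (length bs)"
  shows "zcomb L bs (k \<cdot>\<^sub>v v) = k \<odot> zcomb L bs v"
proof -
  have cl: "bs ! i \<in> carrier L" if "i < length bs" for i using assms(1) that by auto
  show ?thesis
    unfolding zcomb_def using assms(2) cl
    by (subst finsum_smult_ldistr) (auto intro!: finsum_cong' simp: smult_assoc1[of _ _ "bs ! _", simplified])
qed

lemma form_functional:
  assumes "x \<in> carrier L"
  shows "int_functional L (form L x)" "int_functional L (\<lambda>y. form L y x)"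
  using assms form_add_left form_smult_left form_sym unfolding int_functional_def
  by (auto simp: form_sym[of x])

lemma form_zcomb:
  assumes bs: "set bs \<subseteq> carrier L" and w: "w \<in> carrier_vec (length bs)" and v: "v \<in> carrier_vec (length bs)"
  shows "form L (zcomb L bs v) (zcomb L bs w) = v \<bullet> (gram L bs *\<^sub>v w)"
proof -
  have cl: "bs ! i \<in> carrier L" if "i < length bs" for i using bs that by auto
  have "form L (zcomb L bs v) (zcomb L bs w) = (\<Sum>i<length bs. v $ i * form L (bs ! i) (zcomb L bs w))"
    using functional_zcomb[OF form_functional(2)[OF zcomb_closed[OF bs]] bs] .
  also have "\<dots> = (\<Sum>i<length bs. v $ i * (\<Sum>j<length bs. w $ j * form L (bs ! i) (bs ! j)))"
    using functional_zcomb[OF form_functional(1)[OF cl] bs] by simp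
  also have "\<dots> = v \<bullet> (gram L bs *\<^sub>v w)"
    using w by (simp add: gram_def scalar_prod_def atLeast0LessThan mult.commute)
  finally show ?thesis .
qed

lemma gram_carrier: "gram L bs \<in> carrier_mat (length bs) (length bs)"
  by (simp add: gram_def)

lemma gram_transpose:
  assumes "set bs \<subseteq> carrier L"
  shows "(gram L bs)\<^sup>T = gram L bs"
  using assms by (intro eq_matI) (auto simp: gram_def intro!: form_sym)

lemma zbasis_zero:
  assumes "zbasis L bs"
  shows "zcomb L bs (0\<^sub>v (length bs)) = \<zero>"
proof -
  have bs: "set bs \<subseteq> carrier L" using assms by (simp add: zbasis_iff)
  have "zcomb L bs (0 \<cdot>\<^sub>v 0\<^sub>v (length bs)) = 0 \<odot> zcomb L bs (0\<^sub>v (length bs))"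
    by (rule zcomb_smult[OF bs]) simp
  moreover have "0 \<cdot>\<^sub>v 0\<^sub>v (length bs) = (0\<^sub>v (length bs) :: int vec)" by auto
  ultimately show ?thesis using smult_l_null[OF zcomb_closed[OF bs]] by simp
qed

lemma gram_pos:
  assumes "zbasis L bs" "v \<in> carrier_vec (length bs)" "v \<noteq> 0\<^sub>v (length bs)"
  shows "v \<bullet> (gram L bs *\<^sub>v v) > 0"
proof -
  have bs: "set bs \<subseteq> carrier L" and inj: "inj_on (zcomb L bs) (carrier_vec (length bs))"
    using assms(1) by (auto simp: zbasis_iff bij_betw_def)
  have "zcomb L bs v \<noteq> \<zero>"
    using inj_onD[OF inj, of v "0\<^sub>v (length bs)"] assms zbasis_zero[OF assms(1)] by auto
  then show ?thesis using form_pos_def zcomb_closed[OF bs] form_zcomb[OF bs assms(2,2)] by metis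
qed

lemma gram_matrix_obtain:
  obtains bs where "zbasis L bs" "gram_matrix L = gram L bs"
proof -
  have "\<exists>G bs. zbasis L bs \<and> G = gram L bs" using free_finite_rank by auto
  from someI_ex[OF this] show ?thesis using that unfolding gram_matrix_def by blast
qed

lemma gram_nondegenerate:
  assumes "zbasis L bs" "v \<in> carrier_vec (length bs)" "gram L bs *\<^sub>v v = 0\<^sub>v (length bs)"
  shows "v = 0\<^sub>v (length bs)"
  using gram_pos[OF assms(1,2)] assms by auto

text \<open>Were \<open>bs\<close> longer, the coordinates of its members with respect to
  \<open>cs\<close> would satisfy a nontrivial integral relation. The corresponding combination of
  \<open>bs\<close> is orthogonal to everything, against positive definiteness.\<close>

lemma zbasis_length_le:
  assumes bs: "zbasis L bs" and cs: "zbasis L cs"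
  shows "length bs \<le> length cs"
proof (rule ccontr)
  assume less: "\<not> length bs \<le> length cs"
  have bsc: "set bs \<subseteq> carrier L" and csc: "set cs \<subseteq> carrier L" using bs cs by (auto simp: zbasis_iff)
  have "\<exists>v. v \<in> carrier_vec (length cs) \<and> zcomb L cs v = bs ! j" if "j < length bs" for j
    using cs bsc that unfolding zbasis_iff bij_betw_def by (metis image_iff nth_mem subsetD)
  then obtain u where u: "\<And>j. j < length bs \<Longrightarrow> u j \<in> carrier_vec (length cs)"
    "\<And>j. j < length bs \<Longrightarrow> zcomb L cs (u j) = bs ! j" by metis
  obtain x where x: "\<exists>j\<in>{..<length bs}. x j \<noteq> 0"
    and x0: "\<And>i. i < length cs \<Longrightarrow> (\<Sum>j<length bs. u j $ i * x j) = 0"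
    using int_kernel_vector[of "{..<length cs}" "{..<length bs}" "\<lambda>i j. u j $ i"] less by auto
  let ?v = "vec (length bs) x" and ?y = "zcomb L bs (vec (length bs) x)"
  have y: "?y \<in> carrier L" using zcomb_closed[OF bsc] .
  have "form L ?y z = 0" if "z \<in> carrier L" for z
  proof -
    have "form L ?y z = (\<Sum>j<length bs. x j * form L (zcomb L cs (u j)) z)"
      using functional_zcomb[OF form_functional(2)[OF that] bsc, of ?v] u by simp
    also have "\<dots> = (\<Sum>j<length bs. x j * (\<Sum>i<length cs. u j $ i * form L (cs ! i) z))"
      using functional_zcomb[OF form_functional(2)[OF that] csc] by simp
    also have "\<dots> = (\<Sum>i<length cs. (\<Sum>j<length bs. u j $ i * x j) * form L (cs ! i) z)"
      unfolding sum_distrib_left sum_distrib_right by (subst sum.swap) (simp add: algebra_simps)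
    finally show ?thesis using x0 by simp
  qed
  then have "?v \<bullet> (gram L bs *\<^sub>v ?v) = 0" using form_zcomb[OF bsc, of ?v ?v] y by simp
  moreover have "?v \<noteq> 0\<^sub>v (length bs)" using x by (metis index_vec index_zero_vec(1) lessThan_iff)
  ultimately show False using gram_pos[OF bs, of ?v] by simp
qed

lemma lattice_rank_eq:
  assumes "zbasis L bs"
  shows "lattice_rank L = length bs"
  unfolding lattice_rank_def using assms zbasis_length_le by (intro the_equality) (auto intro: antisym)

lemma elementary_divisors_eq:
  assumes "smith_diagonal (gram_matrix L) ds"
  shows "elementary_divisors L = ds"
proof -
  obtain bs where "gram_matrix L = gram L bs" by (rule gram_matrix_obtain)
  then have G: "gram_matrix L \<in> carrier_mat (length bs) (length bs)" using gram_carrier[of bs] by simp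
  show ?thesis
    unfolding elementary_divisors_def using assms smith_diagonal_unique[OF _ assms G] by (intro some_equality)
qed

lemma level_multiple_lattice_level: "level_multiple (gram_matrix L) (lattice_level L)"
proof -
  obtain bs where bs: "zbasis L bs" "gram_matrix L = gram L bs" by (rule gram_matrix_obtain)
  then have G: "gram_matrix L \<in> carrier_mat (length bs) (length bs)" using gram_carrier[of bs] by simp
  have "\<exists>m. level_multiple (gram_matrix L) m"
    using level_multiple_exists[OF G] gram_nondegenerate[OF bs(1)] bs(2) by auto
  then show ?thesis unfolding lattice_level_eq[OF G] by (rule LeastI_ex)
qed

text \<open>The hypothesis \<open>dual\<close> says that \<open>Q\<close> annihilates the
  discriminant group, so \<open>Q\<close> times the inverse Gram matrix is integral; doubling makes
  its diagonal even.\<close>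

lemma lattice_level_dvd:
  assumes Q: "Q > 0"
    and dual: "\<And>\<phi>. int_functional L \<phi> \<Longrightarrow> \<exists>z\<in>carrier L. \<forall>y\<in>carrier L. form L y z = int Q * \<phi> y"
  shows "lattice_level L dvd 2 * Q"
proof -
  obtain bs where bs: "zbasis L bs" "gram_matrix L = gram L bs" by (rule gram_matrix_obtain)
  define n where "n = length bs"
  have G: "gram_matrix L \<in> carrier_mat n n" using gram_carrier[of bs] bs by (simp add: n_def)
  have bsc: "set bs \<subseteq> carrier L" and bij: "bij_betw (zcomb L bs) (carrier_vec n) (carrier L)"
    using bs by (auto simp: zbasis_iff n_def)
  define coord where "coord = inv_into (carrier_vec n) (zcomb L bs)"
  have coord: "coord y \<in> carrier_vec n" "zcomb L bs (coord y) = y" if "y \<in> carrier L" for y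
    using that bij by (auto simp: coord_def bij_betw_def intro: inv_into_into f_inv_into_f)
  have coord_comb: "coord (zcomb L bs v) = v" if "v \<in> carrier_vec n" for v
    using that bij by (simp add: coord_def bij_betw_def inv_into_f_f)
  have coord_fun: "int_functional L (\<lambda>y. coord y $ c)" if "c < n" for c
  proof -
    have "coord (x \<oplus> y) = coord x + coord y" if "x \<in> carrier L" "y \<in> carrier L" for x y
      using zcomb_add[OF bsc, of "coord x" "coord y"] coord[OF that(1)] coord[OF that(2)]
        coord_comb[of "coord x + coord y"] by (simp add: n_def)
    moreover have "coord (k \<odot> x) = k \<cdot>\<^sub>v coord x" if "x \<in> carrier L" for k x
      using zcomb_smult[OF bsc, of "coord x"] coord[OF that] coord_comb[of "k \<cdot>\<^sub>v coord x"] by (simp add: n_def)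
    moreover have "dim_vec (coord x) = n" if "x \<in> carrier L" for x
      using coord(1)[OF that] by simp
    ultimately show ?thesis using that by (simp add: int_functional_def)
  qed
  have "\<exists>z. z \<in> carrier L \<and> (\<forall>y\<in>carrier L. form L y z = int Q * coord y $ c)" if "c < n" for c
    using dual[OF coord_fun[OF that]] by blast
  then obtain z where z: "\<And>c. c < n \<Longrightarrow> z c \<in> carrier L"
    "\<And>c y. c < n \<Longrightarrow> y \<in> carrier L \<Longrightarrow> form L y (z c) = int Q * coord y $ c" by metis
  \<comment> \<open>The vector \<open>z c\<close> represents \<open>Q\<close> times the coordinate
    functional \<open>c\<close>, so its coordinates form column \<open>c\<close> of \<open>Q\<close>
    times the inverse Gram matrix.\<close>
  define K where "K = mat n n (\<lambda>(i, c). 2 * coord (z c) $ i)"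
  have K: "K \<in> carrier_mat n n" by (simp add: K_def)
  have cl: "bs ! i \<in> carrier L" if "i < n" for i using bsc that by (auto simp: n_def)
  have unit: "coord (bs ! i) = unit_vec n i" if "i < n" for i
  proof -
    have "zcomb L bs (unit_vec n i) = bs ! i"
    proof -
      have "zcomb L bs (unit_vec n i) = finsum L (\<lambda>j. if i = j then bs ! j else \<zero>) {..<n}"
        unfolding zcomb_def n_def[symmetric] using that cl smult_one smult_l_null
        by (intro finsum_cong') auto
      then show ?thesis using that cl by (subst (asm) finsum_singleton) auto
    qed
    then show ?thesis using coord_comb[of "unit_vec n i"] by simp
  qed
  have GK: "gram_matrix L * K = int (2 * Q) \<cdot>\<^sub>m 1\<^sub>m n"
  proof (rule eq_matI)
    fix i c assume "i < dim_row (int (2 * Q) \<cdot>\<^sub>m 1\<^sub>m n)" "c < dim_col (int (2 * Q) \<cdot>\<^sub>m 1\<^sub>m n)"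
    then have ic: "i < n" "c < n" by auto
    have "(gram_matrix L * K) $$ (i, c) = 2 * (\<Sum>j<n. coord (z c) $ j * form L (bs ! i) (bs ! j))"
      using ic bs by (simp add: K_def gram_def n_def scalar_prod_def atLeast0LessThan sum_distrib_left algebra_simps)
    also have "\<dots> = 2 * form L (bs ! i) (z c)"
      using functional_zcomb[OF form_functional(1)[OF cl[OF ic(1)]] bsc, of "coord (z c)"] coord(2)[OF z(1)[OF ic(2)]]
      by (simp add: n_def)
    also have "\<dots> = (int (2 * Q) \<cdot>\<^sub>m 1\<^sub>m n) $$ (i, c)"
      using z(2)[OF ic(2) cl[OF ic(1)]] unit[OF ic(1)] ic by auto
    finally show "(gram_matrix L * K) $$ (i, c) = (int (2 * Q) \<cdot>\<^sub>m 1\<^sub>m n) $$ (i, c)" .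
  qed (use G K in auto)
  have "level_multiple (gram_matrix L) (2 * Q)"
    unfolding level_multiple_def using G K GK Q scalar_inverse_commute[OF G K GK]
    by (auto intro!: bexI[of _ K] simp: K_def)
  then show ?thesis using Least_level_multiple_dvd[OF G] lattice_level_eq[OF G] by simp
qed

end


section \<open>The block lattice\<close>

text \<open>
  The coordinates \<open>a < E\<close> are distributed over blocks of size \<open>d i\<close> by \<open>blk\<close>; the permutation \<open>s\<close> is a
  single cycle on each block, and \<open>p i\<close> is a base point of the block \<open>i\<close>. The matrix \<open>S\<close> is
  \<open>g\<close> with its columns divided by the \<open>d j\<close>, and \<open>T\<close> is its inverse.
\<close>

locale glue =
  fixes E n :: nat and blk s p :: "nat \<Rightarrow> nat" and d q r Qc :: "nat \<Rightarrow> int" and D Q :: int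
    and g gam S T :: "nat \<Rightarrow> nat \<Rightarrow> int"
  assumes blk: "a < E \<Longrightarrow> blk a < n"
    and card_blk: "i < n \<Longrightarrow> int (card {a. a < E \<and> blk a = i}) = d i"
    and s_bij: "bij_betw s {..<E} {..<E}"
    and blk_s: "a < E \<Longrightarrow> blk (s a) = blk a"
    and s_trans: "\<And>f :: nat \<Rightarrow> int. \<And>a b. (\<And>a. a < E \<Longrightarrow> f (s a) = f a) \<Longrightarrow>
        a < E \<Longrightarrow> b < E \<Longrightarrow> blk a = blk b \<Longrightarrow> f a = f b"
    and p: "i < n \<Longrightarrow> p i < E" "i < n \<Longrightarrow> blk (p i) = i"
    and d: "i < n \<Longrightarrow> d i > 0" "i < n \<Longrightarrow> odd (d i)" "i < n \<Longrightarrow> d i dvd D" "D > 0"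
    and q: "i < n \<Longrightarrow> q i > 0" "i < n \<Longrightarrow> coprime (q i) (d i)" "i < n \<Longrightarrow> q i * Qc i = Q"
    and r: "i < n \<Longrightarrow> coprime (r i) (d i)" "i < n \<Longrightarrow> r i \<noteq> 0"
    and Q_pos: "Q > 0"
    and g_sym: "i < n \<Longrightarrow> j < n \<Longrightarrow> g i j = g j i"
    and g_even: "i < n \<Longrightarrow> even (g i i)"
    and g_pos: "\<exists>i<n. x i \<noteq> 0 \<Longrightarrow> (\<Sum>i<n. \<Sum>j<n. g i j * x i * x j) > 0"
    and gam: "i < n \<Longrightarrow> j < n \<Longrightarrow> gam i j * (d i * d j) = g i j - (if i = j then d i * q i * (r i)\<^sup>2 else 0)"
    and S: "i < n \<Longrightarrow> j < n \<Longrightarrow> S i j * d j = g i j"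
    and ST: "i < n \<Longrightarrow> j < n \<Longrightarrow> (\<Sum>m<n. S i m * T m j) = (if i = j then 1 else 0)"
begin

lemma gam_sym: "i < n \<Longrightarrow> j < n \<Longrightarrow> gam i j = gam j i"
proof -
  assume ij: "i < n" "j < n"
  have "gam i j * (d i * d j) = gam j i * (d i * d j)"
    using gam[OF ij] gam[OF ij(2,1)] g_sym[OF ij] by (cases "i = j") (auto simp: mult.commute)
  then show ?thesis using d(1)[OF ij(1)] d(1)[OF ij(2)] by simp
qed

abbreviation block :: "nat \<Rightarrow> nat set" where
  "block i \<equiv> {a. a < E \<and> blk a = i}"

definition bsum :: "int vec \<Rightarrow> nat \<Rightarrow> int" where
  "bsum y i = (\<Sum>a\<in>block i. y $ a)"

definition X :: "int vec \<Rightarrow> nat \<Rightarrow> int" where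
  "X y i = bsum y i div r i"

definition M :: "int vec zlattice" where
  "M = zlattice.make {y \<in> carrier_vec E. \<forall>i<n. r i dvd bsum y i} (\<lambda>_ _. 0\<^sub>v E) (0\<^sub>v E) (0\<^sub>v E)
     (+) (\<cdot>\<^sub>v)
     (\<lambda>y z. (\<Sum>a<E. q (blk a) * y $ a * z $ a) + (\<Sum>i<n. \<Sum>j<n. gam i j * X y i * X z j))"

lemma M_simps [simp]:
  "zero M = 0\<^sub>v E" "add M = (+)" "module.smult M = (\<cdot>\<^sub>v)"
  "form M y z = (\<Sum>a<E. q (blk a) * y $ a * z $ a) + (\<Sum>i<n. \<Sum>j<n. gam i j * X y i * X z j)"
  by (simp_all add: M_def zlattice.defs)

lemma M_carrier: "y \<in> carrier M \<longleftrightarrow> y \<in> carrier_vec E \<and> (\<forall>i<n. r i dvd bsum y i)"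
  by (simp add: M_def zlattice.defs)

lemma bsum_X: "y \<in> carrier M \<Longrightarrow> i < n \<Longrightarrow> bsum y i = r i * X y i"
  by (simp add: M_carrier X_def)

lemma bsum_add: "y \<in> carrier_vec E \<Longrightarrow> z \<in> carrier_vec E \<Longrightarrow> bsum (y + z) i = bsum y i + bsum z i"
  unfolding bsum_def sum.distrib[symmetric] by (intro sum.cong) auto

lemma bsum_smult: "y \<in> carrier_vec E \<Longrightarrow> bsum (k \<cdot>\<^sub>v y) i = k * bsum y i"
  unfolding bsum_def sum_distrib_left by (intro sum.cong) auto

lemma X_eqI:
  assumes "i < n" "bsum y i = r i * c"
  shows "X y i = c"
  using assms r(2)[OF assms(1)] by (simp add: X_def)

lemma X_add:
  assumes "y \<in> carrier M" "z \<in> carrier M" "i < n"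
  shows "X (y + z) i = X y i + X z i"
  using assms bsum_X[OF assms(1,3)] bsum_X[OF assms(2,3)]
  by (intro X_eqI) (auto simp: M_carrier bsum_add algebra_simps)

lemma X_smult:
  assumes "y \<in> carrier M" "i < n"
  shows "X (k \<cdot>\<^sub>v y) i = k * X y i"
  using assms bsum_X[OF assms] by (intro X_eqI) (auto simp: M_carrier bsum_smult)

lemma sum_blocks: "(\<Sum>a<E. c (blk a) * u a) = (\<Sum>i<n. c i * (\<Sum>a\<in>block i. u a))" for c u :: "nat \<Rightarrow> int"
proof -
  have "(\<Sum>i<n. \<Sum>a\<in>{a \<in> {..<E}. blk a = i}. c (blk a) * u a) = (\<Sum>a<E. c (blk a) * u a)"
    using blk by (intro sum.group) auto
  then show ?thesis by (simp add: sum_distrib_left)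
qed

lemma module_M: "module int_ring M"
proof (rule moduleI)
  show "cring int_ring" by (rule int_is_cring)
  show "abelian_group M"
  proof (rule abelian_groupI)
    fix x assume "x \<in> carrier M"
    then show "\<exists>y\<in>carrier M. y \<oplus>\<^bsub>M\<^esub> x = \<zero>\<^bsub>M\<^esub>"
      by (intro bexI[of _ "(-1) \<cdot>\<^sub>v x"]) (auto simp: M_carrier bsum_smult intro!: eq_vecI)
  next
    show "\<zero>\<^bsub>M\<^esub> \<in> carrier M" by (auto simp: M_carrier bsum_def)
  qed (auto simp: M_carrier bsum_add assoc_add_vec[of _ E] intro: comm_add_vec[of _ E])
next
  fix a x assume "x \<in> carrier M"
  then show "a \<odot>\<^bsub>M\<^esub> x \<in> carrier M" by (simp add: M_carrier bsum_smult)
next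
  fix a x y assume "x \<in> carrier M" "y \<in> carrier M"
  then show "a \<odot>\<^bsub>M\<^esub> (x \<oplus>\<^bsub>M\<^esub> y) = a \<odot>\<^bsub>M\<^esub> x \<oplus>\<^bsub>M\<^esub> a \<odot>\<^bsub>M\<^esub> y"
    by (simp add: M_carrier smult_add_distrib_vec[of _ E])
qed (simp_all add: add_smult_distrib_vec smult_smult_assoc)

sublocale M: int_module M
  using module_M by (simp add: int_module_def)

lemma coord_functional: "c < E \<Longrightarrow> int_functional M (\<lambda>y. y $ c)"
  by (auto simp: int_functional_def M_carrier)

section \<open>A basis of the block module\<close>

text \<open>In each block the differences with the base point span the vectors of sum zero, and the
  multiple \<open>r i\<close> of the base vector has the sum that generates all admissible
  sums.\<close>

definition bvec :: "nat \<Rightarrow> int vec" where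
  "bvec a = (if a = p (blk a) then r (blk a) \<cdot>\<^sub>v unit_vec E a else unit_vec E a - unit_vec E (p (blk a)))"

definition bs :: "int vec list" where
  "bs = map bvec [0..<E]"

text \<open>Coordinates with respect to \<open>bvec\<close>. The differences do not affect the block
  sum, so the coordinate at the base point is \<open>X y i\<close>.\<close>

definition co :: "int vec \<Rightarrow> int vec" where
  "co y = vec E (\<lambda>c. if c = p (blk c) then X y (blk c) else y $ c)"

lemma bvec_index:
  assumes "a < E" "c < E"
  shows "bvec a $ c = (if a = c then if c = p (blk c) then r (blk c) else 1 else 0)
    - (if c = p (blk c) \<and> blk a = blk c \<and> a \<noteq> c then 1 else 0)"
proof -
  have "p (blk a) < E" "blk (p (blk a)) = blk a" using assms blk p by auto
  then show ?thesis using assms by (auto simp: bvec_def unit_vec_def)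
qed

lemma bvec_carrier: "a < E \<Longrightarrow> bvec a \<in> carrier M"
proof -
  assume a: "a < E"
  have pa: "p (blk a) < E" "blk (p (blk a)) = blk a" using a blk p by auto
  have "r i dvd bsum (bvec a) i" if i: "i < n" for i
  proof (cases "a = p (blk a)")
    case True
    have "bsum (bvec a) i = (\<Sum>c\<in>block i. if c = a then r (blk a) else 0)"
      unfolding bsum_def using a True by (intro sum.cong) (auto simp: bvec_def)
    then show ?thesis using a by (auto simp: sum.delta')
  next
    case False
    have "bsum (bvec a) i = (\<Sum>c\<in>block i. (if c = a then 1 else 0) - (if c = p (blk a) then 1 else 0))"
      unfolding bsum_def using a pa False by (intro sum.cong) (auto simp: bvec_def unit_vec_def)
    then show ?thesis using a pa by (auto simp: sum_subtractf)
  qed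
  then show ?thesis by (auto simp: M_carrier bvec_def)
qed

lemma bs_carrier: "set bs \<subseteq> carrier M"
  using bvec_carrier by (auto simp: bs_def)

lemma zcomb_index:
  assumes "c < E"
  shows "zcomb M bs v $ c = (if c = p (blk c) then r (blk c) * v $ c - (\<Sum>a\<in>block (blk c) - {c}. v $ a) else v $ c)"
proof -
  have "zcomb M bs v $ c = (\<Sum>a<E. v $ a * bvec a $ c)"
    using M.functional_zcomb[OF coord_functional[OF assms] bs_carrier] by (simp add: bs_def)
  also have "\<dots> = (\<Sum>a<E. (if a = c then v $ c * (if c = p (blk c) then r (blk c) else 1) else 0)
      - (if c = p (blk c) \<and> blk a = blk c \<and> a \<noteq> c then v $ a else 0))"
    using assms by (intro sum.cong) (auto simp: bvec_index)
  also have "\<dots> = v $ c * (if c = p (blk c) then r (blk c) else 1) -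
      (\<Sum>a<E. if c = p (blk c) \<and> blk a = blk c \<and> a \<noteq> c then v $ a else 0)"
    using assms by (simp add: sum_subtractf)
  also have "(\<Sum>a<E. if c = p (blk c) \<and> blk a = blk c \<and> a \<noteq> c then v $ a else 0) =
      (if c = p (blk c) then \<Sum>a\<in>block (blk c) - {c}. v $ a else 0)"
    by (auto simp: sum.If_cases intro!: sum.cong)
  finally show ?thesis by (auto simp: mult.commute)
qed

lemma zcomb_co:
  assumes y: "y \<in> carrier M"
  shows "zcomb M bs (co y) = y"
proof (rule eq_vecI)
  show "dim_vec (zcomb M bs (co y)) = dim_vec y"
    using y M.zcomb_closed[OF bs_carrier, of "co y"] by (auto simp: M_carrier)
  fix c assume "c < dim_vec y"
  then have c: "c < E" using y by (auto simp: M_carrier)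
  show "zcomb M bs (co y) $ c = y $ c"
  proof (cases "c = p (blk c)")
    case True
    have "(\<Sum>a\<in>block (blk c) - {c}. co y $ a) = (\<Sum>a\<in>block (blk c) - {c}. y $ a)"
      using True by (intro sum.cong) (auto simp: co_def)
    moreover have "bsum y (blk c) = y $ c + (\<Sum>a\<in>block (blk c) - {c}. y $ a)"
      unfolding bsum_def using c by (intro sum.remove) auto
    ultimately show ?thesis
      using True c bsum_X[OF y blk[OF c]] unfolding zcomb_index[OF c] by (simp add: co_def)
  qed (use c in \<open>simp add: zcomb_index co_def\<close>)
qed

lemma co_zcomb:
  assumes v: "v \<in> carrier_vec E"
  shows "co (zcomb M bs v) = v"
proof (rule eq_vecI)
  fix c assume "c < dim_vec v"
  then have c: "c < E" using v by auto
  show "co (zcomb M bs v) $ c = v $ c"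
  proof (cases "c = p (blk c)")
    case True
    have "bsum (zcomb M bs v) (blk c) = zcomb M bs v $ c + (\<Sum>a\<in>block (blk c) - {c}. zcomb M bs v $ a)"
      unfolding bsum_def using c by (intro sum.remove) auto
    also have "(\<Sum>a\<in>block (blk c) - {c}. zcomb M bs v $ a) = (\<Sum>a\<in>block (blk c) - {c}. v $ a)"
      using True by (intro sum.cong) (auto simp: zcomb_index)
    finally have "bsum (zcomb M bs v) (blk c) = r (blk c) * v $ c"
      using True c by (simp add: zcomb_index)
    then show ?thesis using True c r(2)[OF blk[OF c]] by (simp add: co_def X_def)
  qed (use c in \<open>simp add: zcomb_index co_def\<close>)
qed (use v in \<open>simp add: co_def\<close>)

lemma zbasis_bs: "zbasis M bs"
  unfolding zbasis_iff
proof
  have len: "length bs = E" by (simp add: bs_def)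
  show "bij_betw (zcomb M bs) (carrier_vec (length bs)) (carrier M)"
    unfolding len
  proof (rule bij_betw_byWitness[where f' = co])
    show "zcomb M bs ` carrier_vec E \<subseteq> carrier M" using M.zcomb_closed[OF bs_carrier] by auto
    show "co ` carrier M \<subseteq> carrier_vec E" by (auto simp: co_def)
  qed (use co_zcomb zcomb_co in auto)
qed (rule bs_carrier)

section \<open>Positivity and parity of the form\<close>

text \<open>Cauchy-Schwarz against the constant vector: the sum of the squares of
  \<open>d i * y $ a - bsum y i\<close> over the block is \<open>d i\<close> times the difference of
  the two sides.\<close>

lemma block_cauchy:
  assumes i: "i < n"
  shows "(bsum y i)\<^sup>2 \<le> d i * (\<Sum>a\<in>block i. (y $ a)\<^sup>2)"
proof -
  have "0 \<le> (\<Sum>a\<in>block i. (d i * y $ a - bsum y i)\<^sup>2)" by (intro sum_nonneg) auto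
  also have "\<dots> = (\<Sum>a\<in>block i. d i * d i * (y $ a)\<^sup>2 - 2 * d i * bsum y i * y $ a + (bsum y i)\<^sup>2)"
    by (intro sum.cong) (auto simp: power2_eq_square algebra_simps)
  also have "\<dots> = d i * d i * (\<Sum>a\<in>block i. (y $ a)\<^sup>2) - 2 * d i * bsum y i * bsum y i + d i * (bsum y i)\<^sup>2"
    using card_blk[OF i] by (simp add: sum.distrib sum_subtractf sum_distrib_left[symmetric] bsum_def)
  also have "\<dots> = d i * (d i * (\<Sum>a\<in>block i. (y $ a)\<^sup>2) - (bsum y i)\<^sup>2)"
    by (simp add: power2_eq_square algebra_simps)
  finally show ?thesis using d(1)[OF i] by (simp add: zero_le_mult_iff)
qed

text \<open>If all \<open>X y i\<close> vanish, only the diagonal part is left. Otherwise averaging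
  \<open>y\<close> over each block does not increase the form, and on block-constant vectors the
  form is the positive definite \<open>g\<close>.\<close>

lemma form_pos:
  assumes y: "y \<in> carrier M" and ny: "y \<noteq> 0\<^sub>v E"
  shows "form M y y > 0"
proof (cases "\<exists>i<n. X y i \<noteq> 0")
  case False
  obtain a where a: "a < E" "y $ a \<noteq> 0"
  proof (rule ccontr)
    assume *: "\<not> thesis"
    have "y = 0\<^sub>v E" using y that * by (intro eq_vecI) (auto simp: M_carrier)
    then show False using ny by simp
  qed
  have "0 < (\<Sum>a<E. q (blk a) * (y $ a)\<^sup>2)"
    using q(1) blk a by (intro sum_pos2[of _ a]) (auto simp: less_imp_le)
  then have "0 < (\<Sum>a<E. q (blk a) * y $ a * y $ a)"
    by (simp add: power2_eq_square mult.assoc)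
  then show ?thesis using False by simp
next
  case True
  define Di where "Di i = D div d i" for i
  have Di: "d i * Di i = D" if "i < n" for i using d(3)[OF that] by (simp add: Di_def)
  have Di0: "Di i \<noteq> 0" if "i < n" for i using Di[OF that] d(4) by auto
  \<comment> \<open>The average of \<open>y\<close> over block \<open>i\<close>, multiplied by
    \<open>D\<close> to stay integral, equals \<open>r i * t i\<close>.\<close>
  define t where "t i = X y i * Di i" for i
  have pos: "(\<Sum>i<n. \<Sum>j<n. g i j * t i * t j) > 0" using True Di0 by (intro g_pos) (auto simp: t_def)
  have diag: "q i * d i * (r i)\<^sup>2 * (t i)\<^sup>2 \<le> D\<^sup>2 * (q i * (\<Sum>a\<in>block i. (y $ a)\<^sup>2))" if i: "i < n" for i
  proof -
    have "q i * d i * (Di i)\<^sup>2 * (bsum y i)\<^sup>2 \<le> q i * d i * (Di i)\<^sup>2 * (d i * (\<Sum>a\<in>block i. (y $ a)\<^sup>2))"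
      using block_cauchy[OF i] q(1)[OF i] d(1)[OF i] by (intro mult_left_mono) auto
    also have "\<dots> = (d i * Di i)\<^sup>2 * (q i * (\<Sum>a\<in>block i. (y $ a)\<^sup>2))"
      by (simp add: power2_eq_square)
    also have "q i * d i * (Di i)\<^sup>2 * (bsum y i)\<^sup>2 = q i * d i * (r i)\<^sup>2 * (t i)\<^sup>2"
      by (simp add: bsum_X[OF y i] t_def power2_eq_square)
    finally show ?thesis unfolding Di[OF i] .
  qed
  have off: "D\<^sup>2 * (gam i j * X y i * X y j) = g i j * t i * t j - (if i = j then q i * d i * (r i)\<^sup>2 * (t i)\<^sup>2 else 0)"
    if "i < n" "j < n" for i j
  proof -
    have "D\<^sup>2 * (gam i j * X y i * X y j) = (d i * Di i) * (d j * Di j) * (gam i j * X y i * X y j)"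
      using Di that by (simp add: power2_eq_square)
    also have "\<dots> = (gam i j * (d i * d j)) * t i * t j" by (simp add: t_def)
    finally show ?thesis unfolding gam[OF that] by (auto simp: algebra_simps power2_eq_square)
  qed
  have "D\<^sup>2 * form M y y = (\<Sum>i<n. D\<^sup>2 * (q i * (\<Sum>a\<in>block i. (y $ a)\<^sup>2))) +
     (\<Sum>i<n. \<Sum>j<n. D\<^sup>2 * (gam i j * X y i * X y j))"
    using sum_blocks[of q "\<lambda>a. (y $ a)\<^sup>2"]
    by (simp add: distrib_left sum_distrib_left power2_eq_square mult.assoc)
  also have "(\<Sum>i<n. \<Sum>j<n. D\<^sup>2 * (gam i j * X y i * X y j)) =
     (\<Sum>i<n. \<Sum>j<n. g i j * t i * t j) - (\<Sum>i<n. q i * d i * (r i)\<^sup>2 * (t i)\<^sup>2)"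
    by (simp add: off sum_subtractf)
  also have "(\<Sum>i<n. D\<^sup>2 * (q i * (\<Sum>a\<in>block i. (y $ a)\<^sup>2))) \<ge> (\<Sum>i<n. q i * d i * (r i)\<^sup>2 * (t i)\<^sup>2)"
    using diag by (intro sum_mono) auto
  ultimately have "D\<^sup>2 * form M y y > 0" using pos by linarith
  then show ?thesis using d(4) by (simp add: zero_less_mult_iff)
qed

text \<open>The off-diagonal terms occur in equal pairs.\<close>

lemma even_double_sum:
  fixes b :: "nat \<Rightarrow> nat \<Rightarrow> int"
  assumes "\<And>i j. i < m \<Longrightarrow> j < m \<Longrightarrow> b i j = b j i"
  shows "even ((\<Sum>i<m. \<Sum>j<m. b i j) - (\<Sum>i<m. b i i))"
  using assms
proof (induction m)
  case (Suc m)
  have "(\<Sum>i<m. b i m) = (\<Sum>i<m. b m i)" using Suc.prems by (intro sum.cong) auto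
  moreover have "even ((\<Sum>i<m. \<Sum>j<m. b i j) - (\<Sum>i<m. b i i))" using Suc.prems by (intro Suc.IH) auto
  ultimately show ?case by (simp add: sum.distrib)
qed simp

text \<open>Modulo 2 squares may be replaced by their bases, so the diagonal part becomes the sum of
  the \<open>q i * r i * X y i\<close> and the other part the sum of the
  \<open>gam i i * X y i\<close>. These agree because \<open>d i\<close> is odd and
  \<open>g i i\<close> even.\<close>

lemma form_even:
  assumes y: "y \<in> carrier M"
  shows "even (form M y y)"
proof -
  have gam_parity: "even (gam i i - q i * r i)" if i: "i < n" for i
  proof -
    have "gam i i * (d i * d i) + d i * q i * (r i)\<^sup>2 = g i i" using gam[OF i i] by simp
    then have "even (gam i i * (d i * d i) + d i * q i * (r i)\<^sup>2)" using g_even[OF i] by simp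
    then show ?thesis using d(2)[OF i] by (auto simp: power2_eq_square)
  qed
  have "even ((\<Sum>a<E. q (blk a) * (y $ a * y $ a)) - (\<Sum>a<E. q (blk a) * y $ a))"
    unfolding sum_subtractf[symmetric] by (intro dvd_sum) auto
  moreover have "(\<Sum>a<E. q (blk a) * y $ a) = (\<Sum>i<n. q i * (r i * X y i))"
    unfolding sum_blocks using bsum_X[OF y] by (intro sum.cong) (auto simp: bsum_def)
  moreover have "even ((\<Sum>i<n. \<Sum>j<n. gam i j * X y i * X y j) - (\<Sum>i<n. gam i i * X y i * X y i))"
    by (rule even_double_sum) (simp add: gam_sym mult_ac)
  moreover have "even ((\<Sum>i<n. gam i i * X y i * X y i) - (\<Sum>i<n. q i * (r i * X y i)))"
    unfolding sum_subtractf[symmetric] using gam_parity by (intro dvd_sum) auto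
  ultimately show ?thesis by (simp add: mult.assoc)
qed

sublocale M: zlattice M
proof (intro zlattice.intro zlattice_axioms.intro)
  show "module int_ring M" by (rule module_M)
  show "\<exists>bs. zbasis M bs" using zbasis_bs ..
next
  fix x y z assume "x \<in> carrier M" "y \<in> carrier M" "z \<in> carrier M"
  then have "X (x + y) i = X x i + X y i" if "i < n" for i using that by (simp add: X_add)
  moreover have "(x + y) $ a = x $ a + y $ a" if "a < E" for a
    using that \<open>y \<in> carrier M\<close> by (auto simp: M_carrier)
  ultimately show "form M (x \<oplus>\<^bsub>M\<^esub> y) z = form M x z + form M y z"
    by (simp add: sum.distrib algebra_simps)
next
  fix x y k assume "x \<in> carrier M" "y \<in> carrier M"
  then show "form M (k \<odot>\<^bsub>M\<^esub> x) y = k * form M x y"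
    using X_smult by (auto simp: M_carrier sum_distrib_left algebra_simps)
next
  fix x y assume "x \<in> carrier M" "y \<in> carrier M"
  have "(\<Sum>i<n. \<Sum>j<n. gam i j * X x i * X y j) = (\<Sum>j<n. \<Sum>i<n. gam i j * X x i * X y j)"
    by (rule sum.swap)
  also have "\<dots> = (\<Sum>i<n. \<Sum>j<n. gam i j * X y i * X x j)"
    by (intro sum.cong refl) (simp add: gam_sym mult_ac)
  finally show "form M x y = form M y x" by (simp add: mult_ac)
next
  fix x assume "x \<in> carrier M" "x \<noteq> \<zero>\<^bsub>M\<^esub>"
  then show "form M x x > 0" using form_pos by simp
qed

lemma even_lattice_M: "even_lattice M"
  using form_even M.zlattice_axioms by (auto simp: even_lattice_def simp del: M_simps)

lemma lattice_rank_M: "lattice_rank M = E"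
  using M.lattice_rank_eq[OF zbasis_bs] by (simp add: bs_def)

end


lemma lattice_Aut_mult:
  assumes "f \<in> carrier (lattice_Aut L)" "h \<in> carrier (lattice_Aut L)"
  shows "f \<otimes>\<^bsub>lattice_Aut L\<^esub> h = compose (carrier L) f h"
  using assms by (simp add: lattice_Aut_def BijGroup_def)

lemma lattice_Aut_one: "\<one>\<^bsub>lattice_Aut L\<^esub> = (\<lambda>x\<in>carrier L. x)"
  by (simp add: lattice_Aut_def BijGroup_def)

context glue
begin

text \<open>
  The vector \<open>z\<close> is sought in the form \<open>z a = Qc (blk a) * f a + k (blk a)\<close> with \<open>k\<close> unknown. In terms of
  \<open>w i = X z i\<close> the conditions become the linear system \<open>S w = c\<close>, which is solvable over the
  integers, and \<open>d i\<close> divides what has to be \<open>d i * k i\<close> because \<open>q i * r i\<close> is prime to \<open>d i\<close>.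
\<close>

lemma dual_vector:
  assumes \<phi>: "int_functional M \<phi>"
  shows "\<exists>z\<in>carrier M. \<forall>y\<in>carrier M. form M y z = Q * \<phi> y"
proof -
  \<comment> \<open>These are the coefficients of \<open>\<phi>\<close> in the coordinates
    \<open>co\<close>: \<open>f\<close> at the ordinary positions, set to 0 at the base points, and
    \<open>h\<close> for the base-point coordinates \<open>X y i\<close>.\<close>
  define f where "f a = (if a = p (blk a) then 0 else \<phi> (bvec a))" for a
  define h where "h i = \<phi> (bvec (p i))" for i
  define F where "F i = (\<Sum>a\<in>block i. f a)" for i
  have \<phi>_eq: "\<phi> y = (\<Sum>a<E. f a * y $ a) + (\<Sum>i<n. h i * X y i)" if y: "y \<in> carrier M" for y
  proof -
    have "\<phi> y = (\<Sum>a<E. co y $ a * \<phi> (bvec a))"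
      using M.functional_zcomb[OF \<phi> bs_carrier, of "co y"] zcomb_co[OF y] by (simp add: bs_def)
    also have "\<dots> = (\<Sum>a<E. f a * y $ a + 1 * (if a = p (blk a) then h (blk a) * X y (blk a) else 0))"
      by (intro sum.cong) (auto simp: co_def f_def h_def)
    also have "\<dots> = (\<Sum>a<E. f a * y $ a) + (\<Sum>i<n. 1 * (\<Sum>a\<in>block i. if a = p (blk a) then h (blk a) * X y (blk a) else 0))"
      unfolding sum.distrib sum_blocks[of "\<lambda>_. 1"] ..
    also have "(\<Sum>i<n. 1 * (\<Sum>a\<in>block i. if a = p (blk a) then h (blk a) * X y (blk a) else 0)) = (\<Sum>i<n. h i * X y i)"
    proof (intro sum.cong refl)
      fix i assume "i \<in> {..<n}"
      then have "(\<Sum>a\<in>block i. if a = p (blk a) then h (blk a) * X y (blk a) else 0) =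
         (\<Sum>a\<in>block i. if a = p i then h i * X y i else 0)"
        by (intro sum.cong) auto
      then show "1 * (\<Sum>a\<in>block i. if a = p (blk a) then h (blk a) * X y (blk a) else 0) = h i * X y i"
        using \<open>i \<in> {..<n}\<close> p by simp
    qed
    finally show ?thesis .
  qed
  \<comment> \<open>The right-hand side that remains after eliminating \<open>k\<close> from the
    conditions \<open>q i * r i * k i + G i = Q * h i\<close> and
    \<open>d i * k i = r i * w i - Qc i * F i\<close>.\<close>
  define c where "c i = Q * (d i * h i + r i * F i)" for i
  define w where "w i = (\<Sum>j<n. T i j * c j)" for i
  have Sw: "(\<Sum>m<n. S i m * w m) = c i" if i: "i < n" for i
  proof -
    have "(\<Sum>m<n. S i m * w m) = (\<Sum>j<n. (\<Sum>m<n. S i m * T m j) * c j)"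
      unfolding w_def sum_distrib_left sum_distrib_right by (subst sum.swap) (simp add: mult.assoc)
    also have "\<dots> = (\<Sum>j<n. if i = j then c j else 0)" using i by (intro sum.cong) (auto simp: ST)
    finally show ?thesis using i by simp
  qed
  define G where "G i = (\<Sum>j<n. gam i j * w j)" for i
  have Sgam: "S i j = d i * gam i j + (if i = j then q i * (r i)\<^sup>2 else 0)" if "i < n" "j < n" for i j
  proof -
    have "S i j * d j = (d i * gam i j + (if i = j then q i * (r i)\<^sup>2 else 0)) * d j"
      using S[OF that] gam[OF that] by (auto simp: algebra_simps)
    then show ?thesis using d(1)[OF that(2)] by simp
  qed
  have key: "q i * r i * (r i * w i - Qc i * F i) = d i * (Q * h i - G i)" if i: "i < n" for i
  proof -
    have "c i = (\<Sum>j<n. d i * (gam i j * w j) + (if i = j then q i * (r i)\<^sup>2 * w j else 0))"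
      unfolding Sw[OF i, symmetric] using i by (intro sum.cong) (auto simp: Sgam algebra_simps)
    also have "\<dots> = d i * G i + q i * (r i)\<^sup>2 * w i"
      using i by (simp add: sum.distrib G_def sum_distrib_left)
    finally show ?thesis
      unfolding c_def q(3)[OF i, symmetric] by (simp add: algebra_simps power2_eq_square)
  qed
  define k where "k i = (r i * w i - Qc i * F i) div d i" for i
  have k: "d i * k i = r i * w i - Qc i * F i" if i: "i < n" for i
  proof -
    have "d i dvd (r i * w i - Qc i * F i) * (q i * r i)" using key[OF i] by (metis dvd_triv_left mult.commute)
    then have "d i dvd r i * w i - Qc i * F i"
      using q(2)[OF i] r(1)[OF i] by (subst (asm) coprime_dvd_mult_left_iff) (auto simp: coprime_commute)
    then show ?thesis by (simp add: k_def)
  qed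
  have k2: "q i * r i * k i + G i = Q * h i" if i: "i < n" for i
  proof -
    have "d i * (q i * r i * k i) = d i * (Q * h i - G i)"
      using key[OF i] unfolding k[OF i, symmetric] by (simp add: algebra_simps)
    then show ?thesis using d(1)[OF i] by simp
  qed
  define z where "z = vec E (\<lambda>a. Qc (blk a) * f a + k (blk a))"
  have bz: "bsum z i = r i * w i" if i: "i < n" for i
  proof -
    have "bsum z i = (\<Sum>a\<in>block i. Qc i * f a + k i)"
      unfolding bsum_def by (intro sum.cong) (auto simp: z_def)
    also have "\<dots> = Qc i * F i + d i * k i"
      using card_blk[OF i] by (simp add: sum.distrib sum_distrib_left F_def)
    finally show ?thesis using k[OF i] by simp
  qed
  have zc: "z \<in> carrier M" by (simp add: M_carrier bz) (simp add: z_def)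
  have Xz: "X z i = w i" if "i < n" for i using X_eqI[OF that bz[OF that]] .
  have "form M y z = Q * \<phi> y" if y: "y \<in> carrier M" for y
  proof -
    have "(\<Sum>a<E. q (blk a) * y $ a * z $ a) = (\<Sum>a<E. Q * (f a * y $ a) + (q (blk a) * k (blk a)) * y $ a)"
    proof (intro sum.cong refl)
      fix a assume "a \<in> {..<E}"
      then have "a < E" by simp
      then have "q (blk a) * y $ a * z $ a = (q (blk a) * Qc (blk a)) * (f a * y $ a) + (q (blk a) * k (blk a)) * y $ a"
        by (simp add: z_def algebra_simps)
      then show "q (blk a) * y $ a * z $ a = Q * (f a * y $ a) + (q (blk a) * k (blk a)) * y $ a"
        using q(3)[OF blk[OF \<open>a < E\<close>]] by simp
    qed
    also have "\<dots> = Q * (\<Sum>a<E. f a * y $ a) + (\<Sum>i<n. (q i * k i) * (\<Sum>a\<in>block i. y $ a))"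
      unfolding sum.distrib sum_distrib_left[symmetric] sum_blocks[of "\<lambda>i. q i * k i"] ..
    also have "(\<Sum>i<n. (q i * k i) * (\<Sum>a\<in>block i. y $ a)) = (\<Sum>i<n. q i * r i * k i * X y i)"
      using bsum_X[OF y] by (intro sum.cong) (auto simp: bsum_def)
    finally have 1: "(\<Sum>a<E. q (blk a) * y $ a * z $ a) = Q * (\<Sum>a<E. f a * y $ a) + (\<Sum>i<n. q i * r i * k i * X y i)" .
    have 2: "(\<Sum>i<n. \<Sum>j<n. gam i j * X y i * X z j) = (\<Sum>i<n. G i * X y i)"
      unfolding G_def sum_distrib_right by (intro sum.cong refl) (auto simp: Xz)
    have "form M y z = Q * (\<Sum>a<E. f a * y $ a) + (\<Sum>i<n. (q i * r i * k i + G i) * X y i)"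
      by (simp add: 1 2 sum.distrib distrib_right)
    also have "(\<Sum>i<n. (q i * r i * k i + G i) * X y i) = Q * (\<Sum>i<n. h i * X y i)"
      unfolding sum_distrib_left by (intro sum.cong) (auto simp: k2)
    finally show ?thesis unfolding \<phi>_eq[OF y] by (simp only: distrib_left)
  qed
  then show ?thesis using zc by blast
qed

lemma lattice_level_M: "lattice_level M dvd 2 * nat Q"
proof (rule M.lattice_level_dvd)
  fix \<phi> assume "int_functional M \<phi>"
  then show "\<exists>z\<in>carrier M. \<forall>y\<in>carrier M. form M y z = int (nat Q) * \<phi> y"
    using dual_vector Q_pos by (simp del: M_simps)
qed (use Q_pos in simp)

section \<open>The cyclic shift and its order\<close>

definition shift :: "int vec \<Rightarrow> int vec" where
  "shift = (\<lambda>y\<in>carrier M. vec E (\<lambda>a. y $ s a))"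

lemma s_less: "a < E \<Longrightarrow> s a < E"
  using s_bij by (auto simp: bij_betw_def)

lemma s_block_bij:
  shows "bij_betw s (block i) (block i)"
proof -
  have inj: "inj_on s (block i)" using s_bij by (auto simp: bij_betw_def intro: inj_on_subset)
  moreover have "s ` block i \<subseteq> block i" using s_less blk_s by auto
  ultimately show ?thesis
    using endo_inj_surj[of "block i" s] by (simp add: bij_betw_def)
qed

lemma shift_index: "y \<in> carrier M \<Longrightarrow> a < E \<Longrightarrow> shift y $ a = y $ s a"
  by (simp add: shift_def)

lemma bsum_shift:
  assumes "y \<in> carrier M"
  shows "bsum (shift y) i = bsum y i"
proof -
  have "bsum (shift y) i = (\<Sum>a\<in>block i. y $ s a)"
    unfolding bsum_def using assms by (intro sum.cong) (auto simp: shift_index)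
  also have "\<dots> = bsum y i"
    unfolding bsum_def by (rule sum.reindex_bij_betw[OF s_block_bij])
  finally show ?thesis .
qed

lemma shift_closed: "y \<in> carrier M \<Longrightarrow> shift y \<in> carrier M"
  by (simp add: M_carrier[of "shift y"] bsum_shift) (simp add: M_carrier shift_def)

lemma shift_bij: "bij_betw shift (carrier M) (carrier M)"
proof -
  define t where "t = inv_into {..<E} s"
  have t: "t a < E" "s (t a) = a" if "a < E" for a
    using that s_bij inv_into_into[of a s "{..<E}"] by (auto simp: t_def bij_betw_def f_inv_into_f)
  have st: "t (s a) = a" if "a < E" for a
    using that s_bij by (simp add: t_def bij_betw_def inv_into_f_f)
  define u where "u y = vec E (\<lambda>a. y $ t a)" for y :: "int vec"
  have bu: "bsum (u y) i = bsum y i" for y i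
    unfolding bsum_def
    by (subst sum.reindex_bij_betw[OF s_block_bij, of "\<lambda>a. u y $ a" i, symmetric]) (auto intro!: sum.cong simp: u_def st s_less)
  have uc: "u y \<in> carrier M" if "y \<in> carrier M" for y
    using that by (simp add: M_carrier bu) (simp add: u_def)
  show ?thesis
  proof (rule bij_betw_byWitness[where f' = u])
    show "\<forall>y\<in>carrier M. u (shift y) = y"
      by (auto simp: u_def shift_index t M_carrier intro!: eq_vecI)
    show "\<forall>y\<in>carrier M. shift (u y) = y"
      using uc by (auto simp: shift_def u_def st s_less M_carrier intro!: eq_vecI)
  qed (use uc shift_closed in auto)
qed

lemma shift_isometry: "lattice_isometry M M shift"
  unfolding lattice_isometry_def
proof (intro conjI ballI allI)
  fix x y assume xy: "x \<in> carrier M" "y \<in> carrier M"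
  then have c: "x \<in> carrier_vec E" "y \<in> carrier_vec E" "x + y \<in> carrier M"
    using M.add.m_closed[OF xy] by (auto simp: M_carrier)
  show "shift (x \<oplus>\<^bsub>M\<^esub> y) = shift x \<oplus>\<^bsub>M\<^esub> shift y"
    using xy c s_less by (auto simp: shift_def intro!: eq_vecI)
  have "(\<Sum>a<E. q (blk a) * shift x $ a * shift y $ a) = (\<Sum>a<E. q (blk (s a)) * x $ s a * y $ s a)"
    using xy by (intro sum.cong) (auto simp: shift_index blk_s)
  also have "\<dots> = (\<Sum>a<E. q (blk a) * x $ a * y $ a)"
    by (rule sum.reindex_bij_betw[OF s_bij, of "\<lambda>a. q (blk a) * x $ a * y $ a"])
  finally show "form M (shift x) (shift y) = form M x y"
    using xy by (simp add: X_def bsum_shift)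
next
  fix k x assume x: "x \<in> carrier M"
  then have c: "x \<in> carrier_vec E" "k \<cdot>\<^sub>v x \<in> carrier M"
    using M.smult_closed[of k x] by (auto simp: M_carrier)
  show "shift (k \<odot>\<^bsub>M\<^esub> x) = k \<odot>\<^bsub>M\<^esub> shift x"
    using x c s_less by (auto simp: shift_def intro!: eq_vecI)
qed (rule shift_bij)

lemma shift_Aut: "shift \<in> carrier (lattice_Aut M)"
  using shift_bij shift_isometry by (simp add: lattice_Aut_def Bij_def shift_def)

lemma s_funpow_less: "a < E \<Longrightarrow> (s ^^ m) a < E"
  by (induction m) (simp_all add: s_less)

lemma shift_pow:
  "shift [^]\<^bsub>lattice_Aut M\<^esub> (m :: nat) = (\<lambda>y\<in>carrier M. vec E (\<lambda>a. y $ (s ^^ m) a))"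
proof (induction m)
  case 0
  have "shift [^]\<^bsub>lattice_Aut M\<^esub> (0 :: nat) = (\<lambda>y\<in>carrier M. y)"
    by (simp add: lattice_Aut_one)
  also have "\<dots> = (\<lambda>y\<in>carrier M. vec E (\<lambda>a. y $ (s ^^ 0) a))"
  proof (rule restrict_ext)
    fix y assume "y \<in> carrier M"
    then show "y = vec E (\<lambda>a. y $ (s ^^ 0) a)" by (intro eq_vecI) (auto simp: M_carrier)
  qed
  finally show ?case .
next
  case (Suc m)
  interpret A: group "lattice_Aut M" by (rule M.group_lattice_Aut)
  let ?f = "shift [^]\<^bsub>lattice_Aut M\<^esub> m"
  have "?f \<otimes>\<^bsub>lattice_Aut M\<^esub> shift = compose (carrier M) ?f shift"
    by (rule lattice_Aut_mult[OF A.nat_pow_closed[OF shift_Aut] shift_Aut])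
  then have "shift [^]\<^bsub>lattice_Aut M\<^esub> Suc m = compose (carrier M) ?f shift"
    unfolding A.nat_pow_Suc .
  also have "\<dots> = (\<lambda>y\<in>carrier M. vec E (\<lambda>a. y $ (s ^^ Suc m) a))"
    unfolding compose_def
  proof (rule restrict_ext)
    fix y assume y: "y \<in> carrier M"
    have "?f (shift y) = vec E (\<lambda>a. shift y $ (s ^^ m) a)" unfolding Suc using shift_closed[OF y] by simp
    also have "\<dots> = vec E (\<lambda>a. y $ (s ^^ Suc m) a)"
      by (intro eq_vecI) (simp_all add: shift_index[OF y] s_funpow_less)
    finally show "?f (shift y) = vec E (\<lambda>a. y $ (s ^^ Suc m) a)" .
  qed
  finally show ?case .
qed

lemma shift_ord:
  assumes "\<And>a. a < E \<Longrightarrow> (s ^^ m) a = a"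
  shows "group.ord (lattice_Aut M) shift dvd m"
proof -
  interpret A: group "lattice_Aut M" by (rule M.group_lattice_Aut)
  have "shift [^]\<^bsub>lattice_Aut M\<^esub> m = \<one>\<^bsub>lattice_Aut M\<^esub>"
    unfolding shift_pow lattice_Aut_one using assms
    by (intro restrict_ext eq_vecI) (auto simp: M_carrier)
  then show ?thesis using A.pow_eq_id[OF shift_Aut] by simp
qed

section \<open>The fixed sublattice\<close>

definition tcoord :: "int vec \<Rightarrow> int vec" where
  "tcoord y = vec n (\<lambda>i. y $ p i div r i)"

definition of_tcoord :: "int vec \<Rightarrow> int vec" where
  "of_tcoord t = vec E (\<lambda>a. r (blk a) * t $ blk a)"

lemma bsum_of_tcoord:
  assumes "i < n"
  shows "bsum (of_tcoord t) i = r i * (d i * t $ i)"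
proof -
  have "bsum (of_tcoord t) i = (\<Sum>a\<in>block i. r i * t $ i)"
    unfolding bsum_def by (intro sum.cong) (auto simp: of_tcoord_def)
  then show ?thesis using card_blk[OF assms] by simp
qed

lemma of_tcoord_closed: "of_tcoord t \<in> carrier M"
  by (simp add: M_carrier bsum_of_tcoord) (simp add: of_tcoord_def)

lemma X_of_tcoord: "i < n \<Longrightarrow> X (of_tcoord t) i = d i * t $ i"
  by (rule X_eqI) (auto simp: bsum_of_tcoord)

text \<open>A fixed vector is constant on each block, as \<open>s\<close> is transitive there. Its
  block sum \<open>d i * y $ p i\<close> is divisible by \<open>r i\<close>, which is prime to
  \<open>d i\<close>, so the constant itself is a multiple of \<open>r i\<close>.\<close>

lemma fixed_iff:
  "y \<in> carrier M \<and> shift y = y \<longleftrightarrow> y \<in> of_tcoord ` carrier_vec n"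
proof
  assume y: "y \<in> carrier M \<and> shift y = y"
  have const: "y $ a = y $ p (blk a)" if a: "a < E" for a
  proof (rule s_trans)
    show "y $ s b = y $ b" if "b < E" for b using y shift_index[of y b] that by simp
  qed (use a p blk in auto)
  have "r i dvd y $ p i" if i: "i < n" for i
  proof -
    have "bsum y i = (\<Sum>a\<in>block i. y $ p i)" unfolding bsum_def using const by (intro sum.cong) auto
    moreover have "r i dvd bsum y i" using y i by (simp add: M_carrier)
    ultimately have "r i dvd d i * y $ p i" using card_blk[OF i] by simp
    then show ?thesis using r(1)[OF i] by (simp add: coprime_dvd_mult_right_iff)
  qed
  then have "y = of_tcoord (tcoord y)"
    using y const blk by (auto simp: of_tcoord_def tcoord_def M_carrier intro!: eq_vecI)
  then show "y \<in> of_tcoord ` carrier_vec n" by (auto simp: tcoord_def)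
next
  assume "y \<in> of_tcoord ` carrier_vec n"
  then obtain t where t: "y = of_tcoord t" by blast
  then show "y \<in> carrier M \<and> shift y = y"
    using of_tcoord_closed by (auto simp: shift_def blk_s s_less of_tcoord_def intro!: eq_vecI)
qed

text \<open>On block-constant vectors the diagonal part contributes
  \<open>d i * q i * (r i)\<^sup>2\<close>, exactly the term subtracted in
  \<open>gam\<close>.\<close>

lemma form_of_tcoord:
  "form M (of_tcoord t) (of_tcoord u) = (\<Sum>i<n. \<Sum>j<n. g i j * t $ i * u $ j)"
proof -
  have "(\<Sum>a<E. q (blk a) * of_tcoord t $ a * of_tcoord u $ a) =
      (\<Sum>a<E. (q (blk a) * (r (blk a))\<^sup>2 * t $ blk a * u $ blk a) * 1)"
    by (intro sum.cong) (auto simp: of_tcoord_def power2_eq_square)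
  also have "\<dots> = (\<Sum>i<n. q i * (r i)\<^sup>2 * t $ i * u $ i * (\<Sum>a\<in>block i. 1))"
    by (rule sum_blocks)
  also have "\<dots> = (\<Sum>i<n. \<Sum>j<n. if i = j then d i * q i * (r i)\<^sup>2 * t $ i * u $ j else 0)"
    using card_blk by (intro sum.cong) auto
  finally have 1: "(\<Sum>a<E. q (blk a) * of_tcoord t $ a * of_tcoord u $ a) = \<dots>" .
  have 2: "(\<Sum>i<n. \<Sum>j<n. gam i j * X (of_tcoord t) i * X (of_tcoord u) j) =
      (\<Sum>i<n. \<Sum>j<n. (gam i j * (d i * d j)) * t $ i * u $ j)"
    by (intro sum.cong refl) (auto simp: X_of_tcoord)
  show ?thesis
    unfolding M_simps 1 2 sum.distrib[symmetric]
  proof (intro sum.cong refl)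
    fix i j assume "i \<in> {..<n}" "j \<in> {..<n}"
    then have "gam i j * (d i * d j) = g i j - (if i = j then d i * q i * (r i)\<^sup>2 else 0)" using gam by simp
    then show "(if i = j then d i * q i * (r i)\<^sup>2 * t $ i * u $ j else 0) + gam i j * (d i * d j) * t $ i * u $ j =
      g i j * t $ i * u $ j"
      by (simp only:) (simp add: algebra_simps)
  qed
qed

lemma tcoord_of_tcoord: "t \<in> carrier_vec n \<Longrightarrow> tcoord (of_tcoord t) = t"
  using p r(2) by (auto simp: tcoord_def of_tcoord_def intro!: eq_vecI)

lemma of_tcoord_add:
  "t \<in> carrier_vec n \<Longrightarrow> u \<in> carrier_vec n \<Longrightarrow> of_tcoord t + of_tcoord u = of_tcoord (t + u)"
  using blk by (auto simp: of_tcoord_def distrib_left intro!: eq_vecI)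

lemma of_tcoord_smult: "t \<in> carrier_vec n \<Longrightarrow> k \<cdot>\<^sub>v of_tcoord t = of_tcoord (k \<cdot>\<^sub>v t)"
  using blk by (auto simp: of_tcoord_def intro!: eq_vecI)

end


section \<open>The theorem\<close>

text \<open>The model is the disjoint union of the cyclic groups of order \<open>c i\<close>,
  transported to an initial segment by an enumeration \<open>h\<close>; \<open>s\<close> adds 1 in
  every component.\<close>

lemma block_permutation_exists:
  fixes c :: "nat \<Rightarrow> nat"
  assumes c: "\<And>i. i < n \<Longrightarrow> c i dvd m" and m: "m > 0" and E: "E = (\<Sum>i<n. c i)"
  obtains blk s p where
    "\<And>a. a < E \<Longrightarrow> blk a < n"
    "\<And>i. i < n \<Longrightarrow> card {a. a < E \<and> blk a = i} = c i"
    "bij_betw s {..<E} {..<E}"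
    "\<And>a. a < E \<Longrightarrow> blk (s a) = blk a"
    "\<And>(f :: nat \<Rightarrow> int) a b. (\<And>a. a < E \<Longrightarrow> f (s a) = f a) \<Longrightarrow>
        a < E \<Longrightarrow> b < E \<Longrightarrow> blk a = blk b \<Longrightarrow> f a = f b"
    "\<And>i. i < n \<Longrightarrow> p i < E" "\<And>i. i < n \<Longrightarrow> blk (p i) = i"
    "\<And>a. a < E \<Longrightarrow> (s ^^ m) a = a"
proof -
  have c0: "c i > 0" if "i < n" for i using c[OF that] m by (auto intro!: Nat.gr0I)
  define A where "A = Sigma {..<n} (\<lambda>i. {..<c i})"
  have "card A = E" by (simp add: A_def E)
  moreover have "finite A" by (simp add: A_def)
  ultimately obtain h where h: "bij_betw h {..<E} A"
    using ex_bij_betw_nat_finite[of A] by (auto simp: atLeast0LessThan)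
  define h' where "h' = inv_into {..<E} h"
  have hA: "h a \<in> A" and h'h: "h' (h a) = a" if "a < E" for a
    using h that by (auto simp: h'_def bij_betw_def)
  have h'E: "h' x < E" and hh': "h (h' x) = x" if "x \<in> A" for x
    using h that bij_betwE[OF bij_betw_inv_into[OF h]] by (auto simp: h'_def bij_betw_inv_into_right)
  define s where "s a = h' (fst (h a), Suc (snd (h a)) mod c (fst (h a)))" for a
  define blk where "blk a = fst (h a)" for a
  define p where "p i = h' (i, 0)" for i
  have blkn: "blk a < n" and sndc: "snd (h a) < c (blk a)" if "a < E" for a
    using hA[OF that] by (auto simp: A_def blk_def)
  have st: "(s ^^ t) a = h' (blk a, (snd (h a) + t) mod c (blk a))" if a: "a < E" for a t
  proof (induction t)
    case 0
    show ?case using h'h[OF a] sndc[OF a] by (simp add: blk_def)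
  next
    case (Suc t)
    have "(blk a, (snd (h a) + t) mod c (blk a)) \<in> A"
      using blkn[OF a] c0 by (auto simp: A_def)
    then show ?case using Suc by (simp add: s_def hh' mod_Suc_eq)
  qed
  have sE: "s a < E" and blks: "blk (s a) = blk a" if a: "a < E" for a
  proof -
    have "(blk a, Suc (snd (h a)) mod c (blk a)) \<in> A" using blkn[OF a] c0 by (auto simp: A_def)
    then show "s a < E" "blk (s a) = blk a" using h'E hh' by (auto simp: s_def blk_def)
  qed
  have sm: "(s ^^ m) a = a" if a: "a < E" for a
  proof -
    have "(snd (h a) + m) mod c (blk a) = snd (h a)"
      using c[OF blkn[OF a]] sndc[OF a] by (simp add: mod_add_right_eq[symmetric] dvd_imp_mod_0)
    then show ?thesis using st[OF a, of m] h'h[OF a] by (simp add: blk_def)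
  qed
  have stE: "(s ^^ t) a < E" if "a < E" for a t
    using that by (induction t) (auto intro: sE)
  obtain m' where m': "m = Suc m'" using m by (cases m) auto
  \<comment> \<open>Since \<open>s ^^ m\<close> is the identity, the power
    \<open>s ^^ (m - 1)\<close> is an inverse of \<open>s\<close>.\<close>
  have bij: "bij_betw s {..<E} {..<E}"
  proof (rule bij_betw_byWitness[where f' = "s ^^ m'"])
    show "\<forall>a\<in>{..<E}. (s ^^ m') (s a) = a" using sm by (simp add: m' funpow_swap1)
    show "\<forall>a\<in>{..<E}. s ((s ^^ m') a) = a" using sm by (simp add: m')
  qed (use sE stE in auto)
  have card: "card {a. a < E \<and> blk a = i} = c i" if i: "i < n" for i
  proof -
    have "bij_betw h {a. a < E \<and> blk a = i} (Pair i ` {..<c i})"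
    proof (rule bij_betw_byWitness[where f' = h'])
      show "h ` {a. a < E \<and> blk a = i} \<subseteq> Pair i ` {..<c i}"
        using sndc by (auto simp: blk_def image_iff prod_eq_iff)
      have "(i, j) \<in> A" if "j < c i" for j using i that by (simp add: A_def)
      then show "h' ` Pair i ` {..<c i} \<subseteq> {a. a < E \<and> blk a = i}" "\<forall>x\<in>Pair i ` {..<c i}. h (h' x) = x"
        using h'E hh' by (auto simp: blk_def)
    qed (use h'h in auto)
    then have "card {a. a < E \<and> blk a = i} = card (Pair i ` {..<c i})" by (rule bij_betw_same_card)
    then show ?thesis by (simp add: card_image inj_on_def)
  qed
  have trans: "f a = f b" if f: "\<And>a. a < E \<Longrightarrow> f (s a) = f a" and ab: "a < E" "b < E" "blk a = blk b"
    for f :: "nat \<Rightarrow> int" and a b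
  proof -
    have inv: "f ((s ^^ t) a) = f a" for t
      by (induction t) (use f stE[OF ab(1)] in auto)
    \<comment> \<open>The number of steps from \<open>a\<close> to \<open>b\<close> along the cycle;
      the added cycle length prevents a truncated subtraction.\<close>
    define t where "t = snd (h b) + (c (blk a) - snd (h a))"
    have "snd (h a) + t = snd (h b) + c (blk a)" using sndc[OF ab(1)] by (simp add: t_def)
    then have "(snd (h a) + t) mod c (blk a) = snd (h b)" using sndc[OF ab(2)] ab(3) by simp
    then have "(s ^^ t) a = b" using st[OF ab(1), of t] h'h[OF ab(2)] ab(3) by (simp add: blk_def)
    then show ?thesis using inv[of t] by simp
  qed
  have p: "p i < E" "blk (p i) = i" if "i < n" for i
  proof -
    have "(i, 0) \<in> A" using that c0 by (simp add: A_def)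
    then show "p i < E" "blk (p i) = i" using h'E hh' by (auto simp: p_def blk_def)
  qed
  show ?thesis
    using blkn card bij blks trans p sm by (rule that)
qed

lemma mult_mat_vec_left_inverse:
  assumes "Y * P = 1\<^sub>m n" "Y \<in> carrier_mat n n" "P \<in> carrier_mat n n" "t \<in> carrier_vec n"
  shows "Y *\<^sub>v (P *\<^sub>v t) = (t :: int vec)"
proof -
  have "Y *\<^sub>v (P *\<^sub>v t) = (Y * P) *\<^sub>v t" by (rule assoc_mult_mat_vec[symmetric]) (use assms in auto)
  then show ?thesis using assms by simp
qed

lemma (in glue) tcoord_carrier: "tcoord y \<in> carrier_vec n"
  by (simp add: tcoord_def)

text \<open>The isometry reads off the coordinates \<open>t\<close> of a fixed vector, applies the
  base change \<open>P\<close> and forms the combination of \<open>cs\<close>; the forms match by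
  the hypothesis \<open>g\<close> and the form on block-constant vectors.\<close>

lemma (in glue) fixed_isometric:
  assumes L: "zlattice L" and cs: "zbasis L cs" "length cs = n"
    and P: "P \<in> carrier_mat n n" "invertible_mat P"
    and g: "\<And>t u. t \<in> carrier_vec n \<Longrightarrow> u \<in> carrier_vec n \<Longrightarrow>
      form L (zcomb L cs (P *\<^sub>v t)) (zcomb L cs (P *\<^sub>v u)) = (\<Sum>i<n. \<Sum>j<n. g i j * t $ i * u $ j)"
  shows "isometric (fixed_sublattice M shift) L"
proof -
  interpret L: zlattice L by (rule L)
  have csc: "set cs \<subseteq> carrier L" and bij: "bij_betw (zcomb L cs) (carrier_vec n) (carrier L)"
    using cs by (auto simp: zbasis_iff)
  obtain Y where Y: "Y * P = 1\<^sub>m n" "Y \<in> carrier_mat n n" "P * Y = 1\<^sub>m n"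
    using invertible_matE[OF P(2,1)] .
  let ?N = "fixed_sublattice M shift"
  have N: "carrier ?N = of_tcoord ` carrier_vec n" "add ?N = (+)" "module.smult ?N = (\<cdot>\<^sub>v)" "form ?N = form M"
    using fixed_iff by (auto simp: fixed_sublattice_def simp del: M_simps(4))
  define f where "f y = zcomb L cs (P *\<^sub>v tcoord y)" for y
  have f: "f (of_tcoord t) = zcomb L cs (P *\<^sub>v t)" if "t \<in> carrier_vec n" for t
    using that by (simp add: f_def tcoord_of_tcoord)
  have Pc: "P *\<^sub>v t \<in> carrier_vec n" if "t \<in> carrier_vec n" for t using P that by simp
  have "bij_betw tcoord (carrier ?N) (carrier_vec n)"
    unfolding N by (rule bij_betw_byWitness[where f' = of_tcoord]) (auto simp: tcoord_of_tcoord tcoord_carrier)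
  moreover have "bij_betw ((*\<^sub>v) P) (carrier_vec n) (carrier_vec n)"
    by (rule bij_betw_byWitness[where f' = "(*\<^sub>v) Y"])
      (use P Y in \<open>auto simp: mult_mat_vec_left_inverse[OF Y(1,2) P(1)] mult_mat_vec_left_inverse[OF Y(3) P(1) Y(2)]\<close>)
  ultimately have "bij_betw (zcomb L cs \<circ> ((*\<^sub>v) P \<circ> tcoord)) (carrier ?N) (carrier L)"
    using bij by (intro bij_betw_trans)
  then have "bij_betw f (carrier ?N) (carrier L)"
    by (simp add: f_def[abs_def] comp_def)
  moreover have "f (x \<oplus>\<^bsub>?N\<^esub> y) = f x \<oplus>\<^bsub>L\<^esub> f y" if xy: "x \<in> carrier ?N" "y \<in> carrier ?N" for x y
  proof -
    obtain t u where t: "x = of_tcoord t" "t \<in> carrier_vec n" and u: "y = of_tcoord u" "u \<in> carrier_vec n"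
      using xy by (auto simp: N(1))
    have "f (x + y) = zcomb L cs (P *\<^sub>v t + P *\<^sub>v u)"
      using t u P by (simp add: of_tcoord_add f mult_add_distrib_mat_vec[of _ n n])
    then show ?thesis
      unfolding N using t u Pc by (simp add: L.zcomb_add[OF csc] f cs(2))
  qed
  moreover have "f (k \<odot>\<^bsub>?N\<^esub> x) = k \<odot>\<^bsub>L\<^esub> f x" if x: "x \<in> carrier ?N" for k x
  proof -
    obtain t where t: "x = of_tcoord t" "t \<in> carrier_vec n"
      using x by (auto simp: N(1))
    have "P *\<^sub>v (k \<cdot>\<^sub>v t) = k \<cdot>\<^sub>v (P *\<^sub>v t)" using t P by (intro eq_vecI) auto
    then have "f (k \<cdot>\<^sub>v x) = zcomb L cs (k \<cdot>\<^sub>v (P *\<^sub>v t))"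
      using t P by (simp add: of_tcoord_smult f)
    then show ?thesis
      unfolding N using t Pc by (simp add: L.zcomb_smult[OF csc] f cs(2))
  qed
  moreover have "form L (f x) (f y) = form ?N x y" if "x \<in> carrier ?N" "y \<in> carrier ?N" for x y
    using that unfolding N by (auto simp: f g form_of_tcoord simp del: M_simps)
  ultimately show ?thesis
    unfolding isometric_def lattice_isometry_def by blast
qed


theorem theorem3:
  fixes l :: nat and \<Lambda> :: "'a zlattice"
  assumes "prime l" and "l \<ge> 5"
    and "even_lattice \<Lambda>"
    and "\<exists>k. lattice_level \<Lambda> = l ^ k"
  shows "\<exists>(\<Lambda>' :: int vec zlattice) \<sigma>.
           even_lattice \<Lambda>' \<and>
           \<sigma> \<in> carrier (lattice_Aut \<Lambda>') \<and>
           (\<exists>m. group.ord (lattice_Aut \<Lambda>') \<sigma> = l ^ m) \<and>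
           isometric (fixed_sublattice \<Lambda>' \<sigma>) \<Lambda> \<and>
           lattice_rank \<Lambda>' = elementary_divisor_sum \<Lambda> \<and>
           \<not> l dvd lattice_level \<Lambda>' \<and>
           (\<forall>p. prime p \<and> [int p = - 1] (mod int l) \<longrightarrow> \<not> p dvd lattice_level \<Lambda>')"
proof -
  have zl: "zlattice \<Lambda>" and ev: "\<And>x. x \<in> carrier \<Lambda> \<Longrightarrow> even (form \<Lambda> x x)"
    using assms(3) by (auto simp: even_lattice_def)
  interpret L: zlattice \<Lambda> by (rule zl)
  obtain k where lev: "lattice_level \<Lambda> = l ^ k" using assms(4) by blast
  have odd_l: "odd l" using assms(1,2) prime_odd_nat[of l] by simp
  have pl: "prime (int l)" using assms(1) by simp
  obtain cs where cs: "zbasis \<Lambda> cs" and gm: "gram_matrix \<Lambda> = gram \<Lambda> cs" by (rule L.gram_matrix_obtain)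
  define n where "n = length cs"
  define G where "G = gram \<Lambda> cs"
  have csc: "set cs \<subseteq> carrier \<Lambda>" using cs by (simp add: zbasis_iff)
  have G: "G \<in> carrier_mat n n" "G\<^sup>T = G"
    using L.gram_carrier[of cs] L.gram_transpose[OF csc] by (auto simp: G_def n_def)
  \<comment> \<open>By the definition of the level, \<open>l ^ k\<close> times the inverse of
    \<open>G\<close> is integral.\<close>
  obtain K where K: "K \<in> carrier_mat n n" "G * K = int l ^ k \<cdot>\<^sub>m 1\<^sub>m n"
    using L.level_multiple_lattice_level G by (auto simp: lev gm G_def[symmetric] level_multiple_def)
  obtain P S e where P: "P \<in> carrier_mat n n" "invertible_mat P" and S: "S \<in> carrier_mat n n" "invertible_mat S"
    and SB: "\<And>i j. i < n \<Longrightarrow> j < n \<Longrightarrow> (P\<^sup>T * G * P) $$ (i, j) = S $$ (i, j) * int l ^ e j"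
    and Sl: "\<And>i. i < n \<Longrightarrow> \<not> int l dvd S $$ (i, i)" and ek: "\<And>i. i < n \<Longrightarrow> e i \<le> k"
    and off: "\<And>i j. i < n \<Longrightarrow> j < n \<Longrightarrow> i \<noteq> j \<Longrightarrow> int l ^ (2 * k) dvd (P\<^sup>T * G * P) $$ (i, j)"
    and smith: "smith_diagonal G (map (\<lambda>i. l ^ e i) [0..<n])"
    using int_gram_normal_form[OF assms(1) odd_l G K] by blast
  define B where "B = P\<^sup>T * G * P"
  have B: "B \<in> carrier_mat n n" using P G by (simp add: B_def mult_carrier_mat[of _ n n _ n] del: assoc_mult_mat)
  obtain T where T: "T \<in> carrier_mat n n" "S * T = 1\<^sub>m n" using invertible_matE[OF S(2,1)] by blast
  have form_B: "form \<Lambda> (zcomb \<Lambda> cs (P *\<^sub>v t)) (zcomb \<Lambda> cs (P *\<^sub>v u)) = (\<Sum>i<n. \<Sum>j<n. B $$ (i, j) * t $ i * u $ j)"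
    if t: "t \<in> carrier_vec n" and u: "u \<in> carrier_vec n" for t u
  proof -
    have "form \<Lambda> (zcomb \<Lambda> cs (P *\<^sub>v t)) (zcomb \<Lambda> cs (P *\<^sub>v u)) = (P *\<^sub>v t) \<bullet> (G *\<^sub>v (P *\<^sub>v u))"
      using P t u by (subst L.form_zcomb[OF csc]) (auto simp: n_def G_def)
    also have "\<dots> = (G *\<^sub>v (P *\<^sub>v u)) \<bullet> (P *\<^sub>v t)"
      using P G t u by (intro comm_scalar_prod[of _ n]) auto
    also have "\<dots> = (P\<^sup>T *\<^sub>v (G *\<^sub>v (P *\<^sub>v u))) \<bullet> t"
      using P G t u by (intro transpose_vec_mult_scalar[symmetric]) auto
    also have "P\<^sup>T *\<^sub>v (G *\<^sub>v (P *\<^sub>v u)) = B *\<^sub>v u"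
      using P G u by (simp add: B_def assoc_mult_mat_vec[of _ n n _ n] mult_carrier_mat[of _ n n _ n])
    also have "\<dots> \<bullet> t = (\<Sum>i<n. \<Sum>j<n. B $$ (i, j) * t $ i * u $ j)"
      using B t u by (simp add: scalar_prod_def atLeast0LessThan sum_distrib_right sum_distrib_left mult_ac)
    finally show ?thesis .
  qed
  have B_sym: "B $$ (i, j) = B $$ (j, i)" if "i < n" "j < n" for i j
  proof -
    have "B\<^sup>T = P\<^sup>T * (P\<^sup>T * G)\<^sup>T"
      unfolding B_def using P G by (intro transpose_mult[of _ n n]) (auto simp: mult_carrier_mat[of _ n n _ n])
    also have "(P\<^sup>T * G)\<^sup>T = G * P" using P G by (simp add: transpose_mult[of _ n n])
    also have "P\<^sup>T * (G * P) = B" unfolding B_def using P G by (simp add: assoc_mult_mat[of _ n n _ n _ n])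
    finally have "B\<^sup>T = B" .
    then show ?thesis using B that by (metis carrier_matD index_transpose_mat(1))
  qed
  have B_even: "even (B $$ (i, i))" if i: "i < n" for i
  proof -
    \<comment> \<open>A diagonal entry of \<open>B\<close> is the norm of a vector of the even
      lattice.\<close>
    have "(\<Sum>a<n. \<Sum>b<n. B $$ (a, b) * unit_vec n i $ a * unit_vec n i $ b) = B $$ (i, i)"
      using i by (simp add: unit_vec_def if_distrib[of "\<lambda>x. _ * x"] cong: if_cong)
    then show ?thesis
      using form_B[of "unit_vec n i" "unit_vec n i"] ev[OF L.zcomb_closed[OF csc], of "P *\<^sub>v unit_vec n i"] by simp
  qed
  have B_pos: "(\<Sum>i<n. \<Sum>j<n. B $$ (i, j) * x i * x j) > 0" if "\<exists>i<n. x i \<noteq> 0" for x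
  proof -
    let ?v = "vec n x"
    obtain Y where Y: "Y * P = 1\<^sub>m n" "Y \<in> carrier_mat n n" using invertible_matE[OF P(2,1)] by blast
    have "P *\<^sub>v ?v \<noteq> 0\<^sub>v n"
    proof
      assume "P *\<^sub>v ?v = 0\<^sub>v n"
      then have "Y *\<^sub>v (P *\<^sub>v ?v) = Y *\<^sub>v 0\<^sub>v n" by simp
      also have "\<dots> = 0\<^sub>v n" using Y(2) by (auto intro!: eq_vecI simp: scalar_prod_def)
      finally have "?v = 0\<^sub>v n" using mult_mat_vec_left_inverse[OF Y P(1)] by simp
      then show False using that by (metis index_vec index_zero_vec(1))
    qed
    then have "(P *\<^sub>v ?v) \<bullet> (gram \<Lambda> cs *\<^sub>v (P *\<^sub>v ?v)) > 0"
      using L.gram_pos[OF cs] P by (simp add: n_def)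
    then have "form \<Lambda> (zcomb \<Lambda> cs (P *\<^sub>v ?v)) (zcomb \<Lambda> cs (P *\<^sub>v ?v)) > 0"
      using P by (subst L.form_zcomb[OF csc]) (auto simp: n_def)
    then show ?thesis using form_B[of ?v ?v] by simp
  qed
  define d where "d i = int l ^ e i" for i
  define a where "a i = S $$ (i, i)" for i
  \<comment> \<open>The least residue lies strictly between 0 and \<open>l\<close>. This makes the
    diagonal part positive and keeps all prime divisors of \<open>q i\<close> below
    \<open>l\<close>.\<close>
  define q where "q i = a i mod int l" for i
  have l0: "int l > 0" using assms(2) by simp
  have q_bounds: "q i > 0" "q i < int l" "\<not> int l dvd q i" if "i < n" for i
  proof -
    show "q i < int l" unfolding q_def using l0 by (rule pos_mod_bound)
    show nd: "\<not> int l dvd q i" using Sl[OF that] by (simp add: q_def a_def dvd_mod_iff)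
    have "q i \<ge> 0" unfolding q_def using l0 by (rule pos_mod_sign)
    moreover have "q i \<noteq> 0" using nd by auto
    ultimately show "q i > 0" by simp
  qed
  have "\<exists>r. int l dvd r - 1 \<and> int l ^ k dvd a i - q i * r\<^sup>2" if "i < n" for i
    using hensel_square[OF pl _ q_bounds(3)[OF that], of "a i"] odd_l by (simp add: q_def dvd_minus_mod)
  then obtain r where r: "\<And>i. i < n \<Longrightarrow> int l dvd r i - 1" "\<And>i. i < n \<Longrightarrow> int l ^ k dvd a i - q i * (r i)\<^sup>2"
    by metis
  have rl: "\<not> int l dvd r i" if "i < n" for i
    using dvd_diff[OF _ r(1)[OF that], of "r i"] pl not_prime_unit by auto
  have cop: "coprime x (d i)" if "\<not> int l dvd x" for x i
    using prime_imp_coprime[OF pl that] by (simp add: d_def coprime_commute)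
  have dk: "d i dvd int l ^ k" if "i < n" for i using ek[OF that] by (simp add: d_def le_imp_power_dvd)
  define gam where "gam i j = (B $$ (i, j) - (if i = j then d i * q i * (r i)\<^sup>2 else 0)) div (d i * d j)" for i j
  have gam: "gam i j * (d i * d j) = B $$ (i, j) - (if i = j then d i * q i * (r i)\<^sup>2 else 0)"
    if "i < n" "j < n" for i j
  proof -
    \<comment> \<open>On the diagonal, \<open>d i\<close> splits off and \<open>l ^ k\<close>, a
      multiple of \<open>d i\<close>, divides \<open>a i - q i * (r i)\<^sup>2\<close>. Off the
      diagonal, \<open>l ^ (2 * k)\<close> is a multiple of \<open>d i * d j\<close>.\<close>
    have "d i * d j dvd B $$ (i, j) - (if i = j then d i * q i * (r i)\<^sup>2 else 0)"
    proof (cases "i = j")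
      case True
      have "B $$ (i, i) - d i * q i * (r i)\<^sup>2 = d i * (a i - q i * (r i)\<^sup>2)"
        using SB[OF that(1,1)] by (simp add: B_def d_def a_def algebra_simps)
      then show ?thesis
        using True dvd_trans[OF dk r(2)] that by (simp add: mult_dvd_mono)
    next
      case False
      have "d i * d j dvd int l ^ k * int l ^ k" using dk that by (intro mult_dvd_mono) auto
      then show ?thesis
        using off[OF that False] False by (auto simp: B_def mult_2 power_add intro: dvd_trans)
    qed
    then show ?thesis by (simp add: gam_def)
  qed
  define E where "E = (\<Sum>i<n. l ^ e i)"
  obtain blk s p where blk: "\<And>a. a < E \<Longrightarrow> blk a < n"
    and card_blk: "\<And>i. i < n \<Longrightarrow> card {a. a < E \<and> blk a = i} = l ^ e i"
    and s: "bij_betw s {..<E} {..<E}" "\<And>a. a < E \<Longrightarrow> blk (s a) = blk a"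
    and s_trans: "\<And>(f :: nat \<Rightarrow> int) a b. (\<And>a. a < E \<Longrightarrow> f (s a) = f a) \<Longrightarrow>
        a < E \<Longrightarrow> b < E \<Longrightarrow> blk a = blk b \<Longrightarrow> f a = f b"
    and p: "\<And>i. i < n \<Longrightarrow> p i < E" "\<And>i. i < n \<Longrightarrow> blk (p i) = i"
    and sk: "\<And>a. a < E \<Longrightarrow> (s ^^ (l ^ k)) a = a"
  proof (rule block_permutation_exists[of n "\<lambda>i. l ^ e i" "l ^ k" E])
    show "l ^ e i dvd l ^ k" if "i < n" for i using ek[OF that] by (rule le_imp_power_dvd)
    show "l ^ k > 0" using l0 by simp
  qed (rule E_def, blast)
  define Q where "Q = (\<Prod>i<n. q i)"
  define Qc where "Qc i = (\<Prod>j\<in>{..<n} - {i}. q j)" for i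
  have Q_pos: "Q > 0" unfolding Q_def using q_bounds(1) by (intro prod_pos) auto
  interpret glue E n blk s p d q r Qc "int l ^ k" Q "\<lambda>i j. B $$ (i, j)" gam "\<lambda>i j. S $$ (i, j)" "\<lambda>i j. T $$ (i, j)"
  proof
    show "q i * Qc i = Q" if "i < n" for i
      unfolding Q_def Qc_def using that by (intro prod.remove[symmetric]) auto
    show "(\<Sum>m<n. S $$ (i, m) * T $$ (m, j)) = (if i = j then 1 else 0)" if "i < n" "j < n" for i j
    proof -
      have "(S * T) $$ (i, j) = (\<Sum>m<n. S $$ (i, m) * T $$ (m, j))"
        using S T(1) that by (simp add: scalar_prod_def atLeast0LessThan)
      then show ?thesis using T(2) that by simp
    qed
    show "r i \<noteq> 0" if "i < n" for i using rl[OF that] by auto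
    show "f a = f b" if "\<And>a. a < E \<Longrightarrow> f (s a) = f a" "a < E" "b < E" "blk a = blk b" for f :: "nat \<Rightarrow> int" and a b
      using that by (rule s_trans)
    show "int (card {a. a < E \<and> blk a = i}) = d i" if "i < n" for i
      using card_blk[OF that] by (simp add: d_def)
    show "S $$ (i, j) * d j = B $$ (i, j)" if "i < n" "j < n" for i j
      using SB[OF that] by (simp add: B_def d_def)
    show "d i > 0" "odd (d i)" for i using l0 odd_l by (simp_all add: d_def)
    show "coprime (q i) (d i)" "coprime (r i) (d i)" if "i < n" for i
      using cop q_bounds(3) rl that by blast+
    show "int l ^ k > 0" using l0 by simp
  qed (fact blk s p q_bounds dk B_sym B_even B_pos gam Q_pos)+
  have "group.ord (lattice_Aut M) shift dvd l ^ k" by (rule shift_ord[OF sk])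
  then have ord: "\<exists>m. group.ord (lattice_Aut M) shift = l ^ m"
    using divides_primepow_nat[OF assms(1)] by blast
  have iso: "isometric (fixed_sublattice M shift) \<Lambda>"
    using fixed_isometric[OF zl cs _ P form_B] by (simp add: n_def)
  have "elementary_divisors \<Lambda> = map (\<lambda>i. l ^ e i) [0..<n]"
    using smith by (intro L.elementary_divisors_eq) (simp add: gm G_def)
  then have rank: "lattice_rank M = elementary_divisor_sum \<Lambda>"
    unfolding lattice_rank_M
    by (simp add: E_def elementary_divisor_sum_def interv_sum_list_conv_sum_set_nat atLeast0LessThan)
  \<comment> \<open>Such a prime divides 2 or one of the \<open>q i\<close>, and all of these are
    less than \<open>l\<close>.\<close>
  have small: "p' < l" if p': "prime p'" "p' dvd lattice_level M" for p'
  proof -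
    have "p' dvd 2 * nat Q" using p'(2) lattice_level_M by (rule dvd_trans)
    then consider "p' dvd 2" | "p' dvd nat Q" using p'(1) by (auto simp: prime_dvd_mult_iff)
    then show ?thesis
    proof cases
      case 1
      then show ?thesis using assms(2) dvd_imp_le[of p' 2] by simp
    next
      case 2
      then have "int p' dvd Q" using Q_pos by (metis int_dvd_int_iff int_nat_eq less_imp_le)
      then obtain i where i: "i < n" "int p' dvd q i"
        using p'(1) unfolding Q_def by (subst (asm) prime_dvd_prod_iff) auto
      then have "int p' \<le> q i" using q_bounds(1) by (intro zdvd_imp_le) auto
      then show ?thesis using q_bounds(2)[OF i(1)] by simp
    qed
  qed
  have nl: "\<not> l dvd lattice_level M" using small[OF assms(1)] by auto
  have np: "\<not> p' dvd lattice_level M" if p': "prime p'" "[int p' = - 1] (mod int l)" for p'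
  proof
    assume "p' dvd lattice_level M"
    then have less: "p' < l" using small p'(1) by blast
    have "int l dvd int (p' + 1)" using p'(2) by (simp add: cong_iff_dvd_diff add.commute)
    then have "l dvd p' + 1" by (simp only: int_dvd_int_iff)
    then have "l \<le> p' + 1" by (rule dvd_imp_le) simp
    \<comment> \<open>The only candidate left is \<open>l - 1\<close>, which is even and exceeds 2
      because \<open>l\<close> is at least 5.\<close>
    then have "l = p' + 1" using less by simp
    then have "even p'" "p' > 2" using odd_l assms(2) by auto
    then show False using prime_odd_nat[OF p'(1)] by simp
  qed
  show ?thesis
    using even_lattice_M shift_Aut ord iso rank nl np by blast
qed


end
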